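(* (a) The unit-lower-triangular polynomial matrix $\mathsf{T}(y,z)=(t_{n,k}(y,z))_{n,k\ge0}$ is coefficientwise totally positive (jointly in $y,z$). (b) The polynomial sequence $\big(T_n(x,y,z)\big)_{n\ge0}$, where $T_n(x,y,z)=\sum_{k=0}^n t_{n,k}(y,z)\,x^k$, is coefficientwise Hankel-totally positive (jointly in $x,y,z$).
   Context: Let $T$ be a rooted tree on a totally ordered vertex set. A vertex $j$ is a descendant of $i$ if the unique path from the root to $j$ passes through $i$ (every vertex is a descendant of itself). An edge $e=ij$ of $T$, where $j$ is a child of $i$, is improper if some descendant of $j$ (possibly $j$ itself) is lower-numbered than $i$, and proper otherwise; $\mathrm{imprope}(T)$, $\mathrm{prope}(T)$ count improper and proper edges. Let $\mathcal{T}^{\langle 1;k\rangle}_{n+1}$ be the set of rooted trees on $[n+1]=\{1,\dots,n+1\}$ in which vertex $1$ has exactly $k$ children, and set $t_{n,k}(y,z)=\sum_{T\in\mathcal{T}^{\langle 1;k\rangle}_{n+1}} y^{\mathrm{imprope}(T)} z^{\mathrm{prope}(T)-k}$ (zero if $k>n$). A matrix with polynomial entries is coefficientwise totally positive if every minor is a polynomial with nonnegative coefficients; a sequence $(a_n)$ of polynomials is coefficientwise Hankel-totally positive if the Hankel matrix $(a_{n+n'})_{n,n'\ge0}$ is coefficientwise totally positive. *)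

theory Defs
  imports "Jordan_Normal_Form.Determinant"
begin

section \<open>Rooted trees\<close>

record 'a rooted_graph =
  Verts :: "'a set"
  Edges :: "'a set set"
  Root :: 'a

definition simple_path :: "'a rooted_graph \<Rightarrow> 'a list \<Rightarrow> bool" where
  "simple_path T p \<longleftrightarrow>
     p \<noteq> [] \<and> set p \<subseteq> Verts T \<and> distinct p \<and> successively (\<lambda>u v. {u, v} \<in> Edges T) p"

definition path_between :: "'a rooted_graph \<Rightarrow> 'a \<Rightarrow> 'a list \<Rightarrow> 'a \<Rightarrow> bool" where
  "path_between T u p v \<longleftrightarrow> simple_path T p \<and> hd p = u \<and> last p = v"

definition graph_cycle :: "'a rooted_graph \<Rightarrow> 'a list \<Rightarrow> bool" where
  "graph_cycle T p \<longleftrightarrow> simple_path T p \<and> length p \<ge> 3 \<and> {last p, hd p} \<in> Edges T"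

definition rooted_tree :: "'a rooted_graph \<Rightarrow> bool" where
  "rooted_tree T \<longleftrightarrow>
     finite (Verts T) \<and> Root T \<in> Verts T \<and>
     (\<forall>e \<in> Edges T. \<exists>u \<in> Verts T. \<exists>v \<in> Verts T. u \<noteq> v \<and> e = {u, v}) \<and>
     (\<forall>u \<in> Verts T. \<forall>v \<in> Verts T. \<exists>p. path_between T u p v) \<and>
     (\<nexists>p. graph_cycle T p)"

definition descendant :: "'a rooted_graph \<Rightarrow> 'a \<Rightarrow> 'a \<Rightarrow> bool" where
  "descendant T i j \<longleftrightarrow> (\<exists>p. path_between T (Root T) p j \<and> i \<in> set p)"

definition children :: "'a rooted_graph \<Rightarrow> 'a \<Rightarrow> 'a set" where
  "children T i = {j. {i, j} \<in> Edges T \<and> descendant T i j}"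

text \<open>Edges are oriented away from the root in the following counts: the pair \<open>(i, j)\<close>
  stands for the edge \<open>ij\<close> in which \<open>j\<close> is a child of \<open>i\<close>.\<close>

definition improper :: "'a::linorder rooted_graph \<Rightarrow> 'a \<Rightarrow> 'a \<Rightarrow> bool" where
  "improper T i j \<longleftrightarrow> (\<exists>l. descendant T j l \<and> l < i)"

definition imprope :: "'a::linorder rooted_graph \<Rightarrow> nat" where
  "imprope T = card {(i, j). j \<in> children T i \<and> improper T i j}"

definition prope :: "'a::linorder rooted_graph \<Rightarrow> nat" where
  "prope T = card {(i, j). j \<in> children T i \<and> \<not> improper T i j}"

definition trees_one_children :: "nat \<Rightarrow> nat \<Rightarrow> nat rooted_graph set" where
  "trees_one_children n k =
     {T. rooted_tree T \<and> Verts T = {1..n} \<and> card (children T 1) = k}"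

section \<open>The generating polynomials\<close>

text \<open>The ring of polynomials in \<open>y, z\<close> is represented as \<open>int poly poly\<close>, with
  \<open>y\<close> the inner and \<open>z\<close> the outer indeterminate; one more \<open>poly\<close> layer adjoins \<open>x\<close>.\<close>

definition y_var :: "int poly poly" where "y_var = [:[:0, 1:]:]"

definition z_var :: "int poly poly" where "z_var = [:0, 1:]"

definition x_var :: "int poly poly poly" where "x_var = [:0, 1:]"

text \<open>The natural-number subtraction does not truncate: the edges from vertex \<open>1\<close> to its
  children are proper, so \<open>prope T \<ge> k\<close>.\<close>

definition t_poly :: "nat \<Rightarrow> nat \<Rightarrow> int poly poly" where
  "t_poly n k =
     (\<Sum>T \<in> trees_one_children (n + 1) k. y_var ^ imprope T * z_var ^ (prope T - k))"

definition T_poly :: "nat \<Rightarrow> int poly poly poly" where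
  "T_poly n = (\<Sum>k = 0..n. smult (t_poly n k) (x_var ^ k))"

section \<open>Coefficientwise total positivity\<close>

definition coeffs_nonneg_yz :: "int poly poly \<Rightarrow> bool" where
  "coeffs_nonneg_yz p \<longleftrightarrow> (\<forall>a b. 0 \<le> coeff (coeff p a) b)"

definition coeffs_nonneg_xyz :: "int poly poly poly \<Rightarrow> bool" where
  "coeffs_nonneg_xyz p \<longleftrightarrow> (\<forall>a b c. 0 \<le> coeff (coeff (coeff p a) b) c)"

text \<open>An infinite matrix is a function of its row and column index. The parameter \<open>nonneg\<close>
  says which ring elements count as nonnegative.\<close>

definition totally_positive :: "('a::comm_ring_1 \<Rightarrow> bool) \<Rightarrow> (nat \<Rightarrow> nat \<Rightarrow> 'a) \<Rightarrow> bool" where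
  "totally_positive nonneg M \<longleftrightarrow>
     (\<forall>r I J. strict_mono_on {..<r} I \<longrightarrow> strict_mono_on {..<r} J \<longrightarrow>
        nonneg (det (mat r r (\<lambda>(a, b). M (I a) (J b)))))"

definition Hankel_totally_positive :: "('a::comm_ring_1 \<Rightarrow> bool) \<Rightarrow> (nat \<Rightarrow> 'a) \<Rightarrow> bool" where
  "Hankel_totally_positive nonneg s \<longleftrightarrow> totally_positive nonneg (\<lambda>n n'. s (n + n'))"

definition unit_lower_triangular :: "(nat \<Rightarrow> nat \<Rightarrow> 'a::{zero,one}) \<Rightarrow> bool" where
  "unit_lower_triangular M \<longleftrightarrow> (\<forall>n. M n n = 1) \<and> (\<forall>n k. n < k \<longrightarrow> M n k = 0)"

end

(*
  A rooted tree is encoded by its parent function. If vertex 1 is not the root, exchanging it with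
  its parent turns the tree into one in which vertex 1 has one more child, which is marked, and one
  improper edge is lost. If vertex 1 is the root, deleting it leaves a forest with k trees; hanging
  the trees that do not contain the new smallest vertex below that vertex gives a tree together with
  a set of k - 1 of the children of its smallest vertex. Hence the row polynomials satisfy
    T_(n+1) - y T_(n+1)' = x T_n(x + z).
  So T_(n+1) arises from T_n by the substitution X -> X + z, multiplication by X and application of
  (1 - y D)^(-1), and each of the three has a totally positive matrix. By the Cauchy-Binet formula
  the production matrix P, the product of these matrices, is totally positive, and then so is the
  matrix with rows e_0 P^n. For Hankel total positivity, expand around the indeterminate x: the
  polynomials T_n(x + X) in X satisfy the same recurrence with the factor X replaced by x + X, whose
  matrix is still totally positive, and their constant terms are the entries (P^n)_(0,0).
*)
theory Submission
  imports Defs "Jordan_Normal_Form.Char_Poly"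
begin

section \<open>The Cauchy--Binet formula\<close>

text \<open>The factor \<open>k + 1\<close> produced by D chooses the marked child of vertex 1, and
  \<open>y\<close> pays for the improper edge lost in the exchange. The substitution X -> X + z is a
  choice for each child of the new smallest vertex: either its subtree is cut off again and hangs
  below vertex 1, which gives X, or it stays, and its edge, always proper, gives \<open>z\<close>.

  Operators act on coefficient rows from the right: row \<open>j\<close> of a matrix is the image of
  X^j. The matrices are infinite, but the left factor of every product has finitely supported rows,
  so each minor is a finite matter. The operator 1 - y D is not inverted as such; it suffices that
  it is injective and that preimages of the monomials are known explicitly.

  Expanding around x collects a whole sum over powers of x in one matrix entry. Since x = 0 gives
  the matrix of part (a), a single statement about the recurrence, over a general ring with an
  abstract notion of nonnegativity, serves both parts.\<close>

lemma det_mult_expand: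
  fixes A B :: "nat \<Rightarrow> nat \<Rightarrow> 'a::comm_ring_1"
  shows "det (mat r r (\<lambda>(i, j). \<Sum>l<w. A i l * B l j)) =
    (\<Sum>f \<in> {0..<r} \<rightarrow>\<^sub>E {..<w}. (\<Prod>i=0..<r. A i (f i)) * det (mat r r (\<lambda>(i, j). B (f i) j)))"
proof -
  have "det (mat r r (\<lambda>(i, j). \<Sum>l<w. A i l * B l j)) =
    (\<Sum>p | p permutes {0..<r}. signof p * (\<Prod>i=0..<r. \<Sum>l<w. A i l * B l (p i)))"
    by (subst det_def'[of _ r]) (auto intro!: sum.cong prod.cong)
  \<comment> \<open>When the product of row sums is multiplied out, \<open>f\<close> records the
    index \<open>l\<close> picked in each row.\<close>
  also have "\<dots> = (\<Sum>p | p permutes {0..<r}. \<Sum>f \<in> {0..<r} \<rightarrow>\<^sub>E {..<w}.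
      (\<Prod>i=0..<r. A i (f i)) * (signof p * (\<Prod>i=0..<r. B (f i) (p i))))"
    by (subst prod_sum_PiE) (auto simp: sum_distrib_left prod.distrib algebra_simps intro!: sum.cong)
  also have "\<dots> = (\<Sum>f \<in> {0..<r} \<rightarrow>\<^sub>E {..<w}. \<Sum>p | p permutes {0..<r}.
      (\<Prod>i=0..<r. A i (f i)) * (signof p * (\<Prod>i=0..<r. B (f i) (p i))))"
    by (rule sum.swap)
  also have "\<dots> = (\<Sum>f \<in> {0..<r} \<rightarrow>\<^sub>E {..<w}.
      (\<Prod>i=0..<r. A i (f i)) * det (mat r r (\<lambda>(i, j). B (f i) j)))"
    by (subst det_def'[of _ r]) (auto simp: sum_distrib_left intro!: sum.cong prod.cong)
  finally show ?thesis .
qed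

text \<open>An injective \<open>f\<close> with image \<open>S\<close> is \<open>e\<close> composed
  with exactly one permutation \<open>p\<close>. Undoing \<open>p\<close> on the rows of
  \<open>B\<close> costs its sign, and the signed products of entries of \<open>A\<close> then add
  up to the other minor.\<close>

lemma sum_inj_with_image:
  fixes A B :: "nat \<Rightarrow> nat \<Rightarrow> 'a::comm_ring_1"
  assumes e: "inj_on e {0..<r}" "e ` {0..<r} = S" and S: "S \<subseteq> {..<w}"
  shows "(\<Sum>f | f \<in> {0..<r} \<rightarrow>\<^sub>E {..<w} \<and> inj_on f {0..<r} \<and> f ` {0..<r} = S.
      (\<Prod>i=0..<r. A i (f i)) * det (mat r r (\<lambda>(i, j). B (f i) j))) =
    det (mat r r (\<lambda>(i, j). A i (e j))) * det (mat r r (\<lambda>(i, j). B (e i) j))"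
    (is "(\<Sum>f \<in> ?F. ?t f) = _")
proof -
  let ?P = "{p. p permutes {0..<r}}"
  have bij_e: "bij_betw e {0..<r} S"
    using e by (simp add: bij_betw_def)
  have "(\<Sum>f\<in>?F. ?t f) = (\<Sum>p\<in>?P. ?t (restrict (e \<circ> p) {0..<r}))"
  \<comment> \<open>\<open>restrict\<close> brings the composition into the extensional function
    space; in the other direction the permutation must be continued by the identity.\<close>
  proof (rule sum.reindex_bij_witness[of _ "\<lambda>p. restrict (e \<circ> p) {0..<r}"
        "\<lambda>f i. if i < r then the_inv_into {0..<r} e (f i) else i"])
    fix f assume f: "f \<in> ?F"
    let ?p = "\<lambda>i. if i < r then the_inv_into {0..<r} e (f i) else i"
    have "bij_betw f {0..<r} S"
      using f by (simp add: bij_betw_def)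
    then have "bij_betw (the_inv_into {0..<r} e \<circ> f) {0..<r} {0..<r}"
      by (rule bij_betw_trans) (rule bij_betw_the_inv_into[OF bij_e])
    then have "bij_betw ?p {0..<r} {0..<r}"
      by (rule bij_betw_cong[THEN iffD1, rotated]) simp
    then show "?p \<in> ?P"
      by (auto intro: bij_imp_permutes)
    have "e (the_inv_into {0..<r} e (f i)) = f i" if "i < r" for i
      using f that e by (intro f_the_inv_into_f) auto
    then show "restrict (e \<circ> ?p) {0..<r} = f"
      using f by (auto simp: restrict_def PiE_def extensional_def fun_eq_iff)
    then show "?t (restrict (e \<circ> ?p) {0..<r}) = ?t f" by simp
  next
    fix p assume p: "p \<in> ?P"
    then have pr: "p permutes {0..<r}" by simp
    then have "bij_betw p {0..<r} {0..<r}" by (rule permutes_imp_bij)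
    then have "bij_betw (e \<circ> p) {0..<r} S" using bij_e by (rule bij_betw_trans)
    then have "bij_betw (restrict (e \<circ> p) {0..<r}) {0..<r} S"
      by (rule bij_betw_cong[THEN iffD1, rotated]) simp
    then show "restrict (e \<circ> p) {0..<r} \<in> ?F"
      using S by (auto simp: bij_betw_def)
    have "p i < r" if "i < r" for i
      using permutes_in_image[OF pr, of i] that by simp
    moreover have "p i = i" if "\<not> i < r" for i
      using permutes_not_in[OF pr, of i] that by simp
    ultimately show "(\<lambda>i. if i < r then the_inv_into {0..<r} e (restrict (e \<circ> p) {0..<r} i) else i) = p"
      using e by (auto simp: fun_eq_iff the_inv_into_f_f)
  qed
  also have "\<dots> = (\<Sum>p\<in>?P. (\<Prod>i=0..<r. A i (e (p i))) *
      (signof p * det (mat r r (\<lambda>(i, j). B (e i) j))))"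
  proof (rule sum.cong[OF refl])
    fix p assume p: "p \<in> ?P"
    then have "det (mat r r (\<lambda>(i, j). B (e (p i)) j)) = 
        det (mat r r (\<lambda>(i, j). mat r r (\<lambda>(i, j). B (e i) j) $$ (p i, j)))"
      by (intro arg_cong[of _ _ det] eq_matI) (auto dest: permutes_in_image)
    also have "\<dots> = signof p * det (mat r r (\<lambda>(i, j). B (e i) j))"
      using p by (intro det_permute_rows) auto
    moreover have "mat r r (\<lambda>(i, j). B (restrict (e \<circ> p) {0..<r} i) j) = mat r r (\<lambda>(i, j). B (e (p i)) j)"
      by (intro eq_matI) auto
    ultimately show "?t (restrict (e \<circ> p) {0..<r}) = (\<Prod>i=0..<r. A i (e (p i))) *
      (signof p * det (mat r r (\<lambda>(i, j). B (e i) j)))" by simp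
  qed
  also have "\<dots> = (\<Sum>p\<in>?P. signof p * (\<Prod>i=0..<r. A i (e (p i)))) * det (mat r r (\<lambda>(i, j). B (e i) j))"
    by (simp add: sum_distrib_left sum_distrib_right algebra_simps)
  also have "(\<Sum>p\<in>?P. signof p * (\<Prod>i=0..<r. A i (e (p i)))) = det (mat r r (\<lambda>(i, j). A i (e j)))"
    by (subst det_def'[of _ r]) (auto intro!: sum.cong prod.cong dest: permutes_in_image)
  finally show ?thesis .
qed

text \<open>A non-injective \<open>f\<close> in the expansion repeats a row of \<open>B\<close> and
  contributes nothing; the injective ones are grouped by their image. Listing \<open>S\<close> in
  increasing order yields the kind of minor that \<open>totally_positive\<close> speaks of.\<close>

lemma Cauchy_Binet:
  fixes A B :: "nat \<Rightarrow> nat \<Rightarrow> 'a::comm_ring_1"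
  shows "det (mat r r (\<lambda>(i, j). \<Sum>l<w. A i l * B l j)) =
    (\<Sum>S | S \<subseteq> {..<w} \<and> card S = r.
      det (mat r r (\<lambda>(i, j). A i (sorted_list_of_set S ! j))) *
      det (mat r r (\<lambda>(i, j). B (sorted_list_of_set S ! i) j)))"
proof -
  let ?F = "{0..<r} \<rightarrow>\<^sub>E {..<w}" and ?\<S> = "{S. S \<subseteq> {..<w} \<and> card S = r}"
  let ?t = "\<lambda>f. (\<Prod>i=0..<r. A i (f i)) * det (mat r r (\<lambda>(i, j). B (f i) j))"
  have fin: "finite ?F" by (intro finite_PiE) auto
  have "det (mat r r (\<lambda>(i, j). \<Sum>l<w. A i l * B l j)) = sum ?t ?F"
    by (rule det_mult_expand)
  also have "\<dots> = sum ?t {f \<in> ?F. inj_on f {0..<r}}"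
  proof (rule sum.mono_neutral_right[OF fin])
    show "\<forall>f \<in> ?F - {f \<in> ?F. inj_on f {0..<r}}. ?t f = 0"
    proof
      fix f assume "f \<in> ?F - {f \<in> ?F. inj_on f {0..<r}}"
      then obtain i j where "i < r" "j < r" "i \<noteq> j" "f i = f j"
        by (auto simp: inj_on_def)
      then have "det (mat r r (\<lambda>(i, j). B (f i) j)) = 0"
        by (intro det_identical_rows[of _ r i j]) auto
      then show "?t f = 0" by simp
    qed
  qed auto
  also have "\<dots> = (\<Sum>S\<in>?\<S>. sum ?t {f \<in> {f \<in> ?F. inj_on f {0..<r}}. f ` {0..<r} = S})"
    using fin by (intro sum.group[symmetric]) (auto simp: card_image intro: finite_subset[of _ "Pow {..<w}"])
  also have "\<dots> = (\<Sum>S\<in>?\<S>.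
      det (mat r r (\<lambda>(i, j). A i (sorted_list_of_set S ! j))) *
      det (mat r r (\<lambda>(i, j). B (sorted_list_of_set S ! i) j)))"
  proof (rule sum.cong[OF refl])
    fix S assume S: "S \<in> ?\<S>"
    then have fS: "finite S" by (auto intro: finite_subset)
    have "inj_on ((!) (sorted_list_of_set S)) {0..<r}"
      using S by (auto simp: inj_on_def nth_eq_iff_index_eq)
    moreover have "(!) (sorted_list_of_set S) ` {0..<r} = S"
      using S fS nth_image[of r "sorted_list_of_set S"] by (simp add: atLeast0LessThan)
    ultimately show "sum ?t {f \<in> {f \<in> ?F. inj_on f {0..<r}}. f ` {0..<r} = S} =
      det (mat r r (\<lambda>(i, j). A i (sorted_list_of_set S ! j))) *
      det (mat r r (\<lambda>(i, j). B (sorted_list_of_set S ! i) j))"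
      using sum_inj_with_image[of "(!) (sorted_list_of_set S)" r S w A B] S by simp
  qed
  finally show ?thesis .
qed

section \<open>Total positivity\<close>

lemma det_row_lincomb:
  fixes W :: "nat \<Rightarrow> nat \<Rightarrow> 'a::comm_ring_1"
  assumes "a < r"
  shows "det (mat r r (\<lambda>(i, j). if i = a then c * u j + d * v j else W i j)) =
    c * det (mat r r (\<lambda>(i, j). if i = a then u j else W i j)) +
    d * det (mat r r (\<lambda>(i, j). if i = a then v j else W i j))"
proof -
  have a: "a \<in> {0..<r}" using assms by simp
  have *: "(\<Prod>i=0..<r. if i = a then f (p i) else W i (p i)) =
      f (p a) * (\<Prod>i\<in>{0..<r} - {a}. W i (p i))" for p :: "nat \<Rightarrow> nat" and f
    by (subst prod.remove[OF _ a]) (auto intro!: prod.cong)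
  have det: "det (mat r r (\<lambda>(i, j). if i = a then f j else W i j)) =
      (\<Sum>p | p permutes {0..<r}. signof p * (f (p a) * (\<Prod>i\<in>{0..<r} - {a}. W i (p i))))" for f
    by (subst det_def'[of _ r]) (auto simp: *[symmetric] intro!: sum.cong prod.cong dest: permutes_in_image)
  show ?thesis
    unfolding det sum_distrib_left sum.distrib[symmetric]
    by (intro sum.cong) (auto simp: algebra_simps)
qed

lemma det_zero_row:
  fixes W :: "nat \<Rightarrow> nat \<Rightarrow> 'a::comm_ring_1"
  assumes "a < r" "\<And>j. j < r \<Longrightarrow> W a j = 0"
  shows "det (mat r r (\<lambda>(i, j). W i j)) = 0"
proof -
  have "mat r r (\<lambda>(i, j). W i j) = mat r r (\<lambda>(i, j). if i = a then 0 * 0 + 0 * 0 else W i j)"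
    using assms by (intro eq_matI) auto
  then show ?thesis
    using det_row_lincomb[OF assms(1), of 0 "\<lambda>_. 0" 0 "\<lambda>_. 0" W] by simp
qed

lemma det_transpose_fun:
  "det (mat r r (\<lambda>(i, j). W i j)) = det (mat r r (\<lambda>(i, j). W j i))"
proof -
  have "mat r r (\<lambda>(i, j). W j i) = transpose_mat (mat r r (\<lambda>(i, j). W i j))"
    by (intro eq_matI) auto
  then show ?thesis by (simp add: det_transpose[of _ r])
qed

lemma totally_positiveI:
  assumes "\<And>r I J. strict_mono_on {..<r} I \<Longrightarrow> strict_mono_on {..<r} J \<Longrightarrow>
    nonneg (det (mat r r (\<lambda>(a, b). M (I a) (J b))))"
  shows "totally_positive nonneg M"
  using assms unfolding totally_positive_def by blast

lemma totally_positiveD: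
  assumes "totally_positive nonneg M" "strict_mono_on {..<r} I" "strict_mono_on {..<r} J"
  shows "nonneg (det (mat r r (\<lambda>(a, b). M (I a) (J b))))"
  using assms unfolding totally_positive_def by blast

section \<open>Operations that preserve total positivity\<close>

lemma totally_positive_transpose:
  assumes "totally_positive nonneg M"
  shows "totally_positive nonneg (\<lambda>i j. M j i)"
proof (rule totally_positiveI)
  fix r I J assume "strict_mono_on {..<r} (I :: nat \<Rightarrow> nat)" "strict_mono_on {..<r} (J :: nat \<Rightarrow> nat)"
  then show "nonneg (det (mat r r (\<lambda>(a, b). M (J b) (I a))))"
    using totally_positiveD[OF assms, of r J I] by (subst det_transpose_fun)
qed

text \<open>A minor involves finitely many rows, so it is already a minor of some
  \<open>A n\<close>. This reduces claims about infinite matrices to inductions in which the rows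
  are put in place one at a time.\<close>

lemma totally_positive_row_limit:
  assumes "\<And>n. totally_positive nonneg (A n)" "\<And>n i. i < n \<Longrightarrow> A n i = M i"
  shows "totally_positive nonneg M"
proof (rule totally_positiveI)
  fix r I J assume I: "strict_mono_on {..<r} (I :: nat \<Rightarrow> nat)" and J: "strict_mono_on {..<r} (J :: nat \<Rightarrow> nat)"
  \<comment> \<open>The sum bounds every row index and, unlike a maximum, makes sense for
    \<open>r = 0\<close>.\<close>
  have "mat r r (\<lambda>(a, b). M (I a) (J b)) = mat r r (\<lambda>(a, b). A (Suc (\<Sum>a<r. I a)) (I a) (J b))"
  proof (rule eq_matI)
    fix a b
    assume "a < dim_row (mat r r (\<lambda>(a, b). A (Suc (\<Sum>a<r. I a)) (I a) (J b)))"
      and "b < dim_col (mat r r (\<lambda>(a, b). A (Suc (\<Sum>a<r. I a)) (I a) (J b)))"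
    then have ab: "a < r" "b < r" by auto
    then have "I a \<le> (\<Sum>a<r. I a)" by (intro member_le_sum) auto
    then show "mat r r (\<lambda>(a, b). M (I a) (J b)) $$ (a, b) =
        mat r r (\<lambda>(a, b). A (Suc (\<Sum>a<r. I a)) (I a) (J b)) $$ (a, b)"
      using ab by (simp add: assms(2) le_imp_less_Suc)
  qed auto
  then show "nonneg (det (mat r r (\<lambda>(a, b). M (I a) (J b))))"
    using totally_positiveD[OF assms(1) I J] by simp
qed

text \<open>Minors are only ever added and multiplied, so a subsemiring is enough to express
  nonnegativity. The instances are the nonnegative integers and, layer by layer, the polynomials
  with nonnegative coefficients.\<close>

locale nonneg_cone =
  fixes nonneg :: "'a::comm_ring_1 \<Rightarrow> bool"
  assumes nonneg_0: "nonneg 0" and nonneg_1: "nonneg 1"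
    and nonneg_add: "nonneg a \<Longrightarrow> nonneg b \<Longrightarrow> nonneg (a + b)"
    and nonneg_mult: "nonneg a \<Longrightarrow> nonneg b \<Longrightarrow> nonneg (a * b)"
begin

lemma nonneg_of_nat: "nonneg (of_nat n)"
  by (induction n) (auto intro: nonneg_0 nonneg_1 nonneg_add)

lemma nonneg_sum: "(\<And>x. x \<in> S \<Longrightarrow> nonneg (f x)) \<Longrightarrow> nonneg (sum f S)"
  by (induction S rule: infinite_finite_induct) (auto intro: nonneg_0 nonneg_add)

text \<open>The bound \<open>w i\<close> on the support of row \<open>i\<close> makes the matrix
  product a finite sum. The rows of one minor have a common bound \<open>m\<close>, and the
  Cauchy-Binet formula then writes the minor as a sum of products of minors.\<close>

lemma totally_positive_mult:
  assumes A: "totally_positive nonneg A" and B: "totally_positive nonneg B"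
    and w: "\<And>i l. w i \<le> l \<Longrightarrow> A i l = 0"
  shows "totally_positive nonneg (\<lambda>i k. \<Sum>l<w i. A i l * B l k)"
proof (rule totally_positiveI)
  fix r I J assume I: "strict_mono_on {..<r} (I :: nat \<Rightarrow> nat)" and J: "strict_mono_on {..<r} (J :: nat \<Rightarrow> nat)"
  define m where "m = (\<Sum>a<r. w (I a))"
  have "mat r r (\<lambda>(a, b). \<Sum>l<w (I a). A (I a) l * B l (J b)) =
      mat r r (\<lambda>(a, b). \<Sum>l<m. A (I a) l * B l (J b))"
  proof (rule eq_matI)
    fix a b
    assume "a < dim_row (mat r r (\<lambda>(a, b). \<Sum>l<m. A (I a) l * B l (J b)))"
      and "b < dim_col (mat r r (\<lambda>(a, b). \<Sum>l<m. A (I a) l * B l (J b)))"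
    then have ab: "a < r" "b < r" by auto
    then have "w (I a) \<le> m" unfolding m_def by (intro member_le_sum) auto
    then have "(\<Sum>l<w (I a). A (I a) l * B l (J b)) = (\<Sum>l<m. A (I a) l * B l (J b))"
      by (intro sum.mono_neutral_left) (auto simp: w)
    then show "mat r r (\<lambda>(a, b). \<Sum>l<w (I a). A (I a) l * B l (J b)) $$ (a, b) =
        mat r r (\<lambda>(a, b). \<Sum>l<m. A (I a) l * B l (J b)) $$ (a, b)"
      using ab by simp
  qed auto
  also have "det \<dots> = (\<Sum>S | S \<subseteq> {..<m} \<and> card S = r.
      det (mat r r (\<lambda>(i, j). A (I i) (sorted_list_of_set S ! j))) *
      det (mat r r (\<lambda>(i, j). B (sorted_list_of_set S ! i) (J j))))"
    by (rule Cauchy_Binet)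
  also have "nonneg \<dots>"
  proof (rule nonneg_sum)
    fix S assume "S \<in> {S. S \<subseteq> {..<m} \<and> card S = r}"
    then have "strict_mono_on {..<r} ((!) (sorted_list_of_set S))"
      by (auto simp: strict_mono_on_def intro!: sorted_wrt_nth_less[OF strict_sorted_list_of_set])
    then show "nonneg (det (mat r r (\<lambda>(i, j). A (I i) (sorted_list_of_set S ! j))) *
      det (mat r r (\<lambda>(i, j). B (sorted_list_of_set S ! i) (J j))))"
      by (intro nonneg_mult totally_positiveD[OF A I] totally_positiveD[OF B _ J])
  qed
  finally show "nonneg (det (mat r r (\<lambda>(a, b). \<Sum>l<w (I a). A (I a) l * B l (J b))))" .
qed

text \<open>A minor through row \<open>i\<close> becomes \<open>c\<close> times the old minor plus
  \<open>d\<close> times the one with row \<open>j\<close> in place of row \<open>i\<close>. As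
  \<open>i\<close> and \<open>j\<close> are adjacent, the latter either has two equal rows or still
  has its rows in increasing order.\<close>

lemma totally_positive_row_op:
  assumes A: "totally_positive nonneg A" and cd: "nonneg c" "nonneg d"
    and ij: "j = Suc i \<or> i = Suc j"
  shows "totally_positive nonneg (A(i := \<lambda>k. c * A i k + d * A j k))"
proof (rule totally_positiveI)
  fix r I J assume I: "strict_mono_on {..<r} (I :: nat \<Rightarrow> nat)" and J: "strict_mono_on {..<r} (J :: nat \<Rightarrow> nat)"
  let ?A = "A(i := \<lambda>k. c * A i k + d * A j k)"
  show "nonneg (det (mat r r (\<lambda>(a, b). ?A (I a) (J b))))"
  proof (cases "i \<in> I ` {..<r}")
    case False
    then have "mat r r (\<lambda>(a, b). ?A (I a) (J b)) = mat r r (\<lambda>(a, b). A (I a) (J b))"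
      by (intro eq_matI) auto
    then show ?thesis using totally_positiveD[OF A I J] by simp
  next
    case True
    then obtain a where a: "a < r" "I a = i" by auto
    have inj: "I a' = i \<longleftrightarrow> a' = a" if "a' < r" for a'
      using strict_mono_on_imp_inj_on[OF I] a that by (auto simp: inj_on_def)
    have "mat r r (\<lambda>(a, b). ?A (I a) (J b)) =
        mat r r (\<lambda>(a', b). if a' = a then c * A i (J b) + d * A j (J b) else A (I a') (J b))"
      using a inj by (intro eq_matI) auto
    then have "det (mat r r (\<lambda>(a, b). ?A (I a) (J b))) =
        c * det (mat r r (\<lambda>(a', b). if a' = a then A i (J b) else A (I a') (J b))) +
        d * det (mat r r (\<lambda>(a', b). if a' = a then A j (J b) else A (I a') (J b)))"
      by (simp add: det_row_lincomb[OF a(1)])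
    moreover have "mat r r (\<lambda>(a', b). if a' = a then A i (J b) else A (I a') (J b)) =
        mat r r (\<lambda>(a, b). A (I a) (J b))"
      using a by (intro eq_matI) auto
    moreover have "nonneg (det (mat r r (\<lambda>(a', b). if a' = a then A j (J b) else A (I a') (J b))))"
    proof (cases "j \<in> I ` {..<r}")
      case True
      then obtain b where b: "b < r" "I b = j" by auto
      then have "b \<noteq> a" using a ij by auto
      then show ?thesis
        using a b by (subst det_identical_rows[of _ r a b]) (auto simp: nonneg_0)
    next
      case False
      have "strict_mono_on {..<r} (I(a := j))"
      proof (rule strict_mono_onI)
        fix s t assume st: "s \<in> {..<r}" "t \<in> {..<r}" "s < t"
        then have "I s < I t" "s \<noteq> a \<Longrightarrow> s < a \<Longrightarrow> I s < I a" "t \<noteq> a \<Longrightarrow> a < t \<Longrightarrow> I a < I t"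
          using I a by (auto simp: strict_mono_on_def)
        moreover have "I s \<noteq> j" "I t \<noteq> j" using False st by auto
        ultimately show "(I(a := j)) s < (I(a := j)) t"
          using a ij st by auto
      qed
      from totally_positiveD[OF A this J] show ?thesis
        by (rule back_subst[of nonneg], intro arg_cong[of _ _ det] eq_matI) auto
    qed
    ultimately show ?thesis
      using totally_positiveD[OF A I J] cd by (auto intro: nonneg_add nonneg_mult)
  qed
qed

lemma totally_positive_zero: "totally_positive nonneg (\<lambda>i j. 0)"
proof (rule totally_positiveI)
  fix r :: nat
  show "nonneg (det (mat r r (\<lambda>(a, b). 0)))"
    using det_zero_row[of 0 r "\<lambda>_ _. 0 :: 'a"] by (cases "r = 0") (auto simp: nonneg_0 nonneg_1)
qed

text \<open>If the row and column indices differ, consider the first position where they do: the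
  smaller of the two indices there does not occur in the other list, so the minor has a zero row or
  a zero column.\<close>

lemma totally_positive_id: "totally_positive nonneg (\<lambda>i j. if i = j then 1 else 0)"
proof (rule totally_positiveI)
  fix r I J assume I: "strict_mono_on {..<r} (I :: nat \<Rightarrow> nat)" and J: "strict_mono_on {..<r} (J :: nat \<Rightarrow> nat)"
  have zero: "det (mat r r (\<lambda>(a, b). if K a = L b then 1 else 0 :: 'a)) = 0"
    if K: "strict_mono_on {..<r} K" and L: "strict_mono_on {..<r} L"
      and a: "a < r" "\<And>b. b < a \<Longrightarrow> K b = L b" "K a < L a"
    for K L :: "nat \<Rightarrow> nat" and a
  proof (rule det_zero_row[OF a(1)])
    fix b assume b: "b < r"
    have "K a \<noteq> L b"
    proof (cases "b < a")
      case True
      then have "K b < K a" using strict_mono_onD[OF K, of b a] a(1) b by simp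
      then show ?thesis using a(2)[OF True] by simp
    next
      case False
      then have "L a \<le> L b" using strict_mono_onD[OF L, of a b] a(1) b by (cases "a = b") auto
      then show ?thesis using a(3) by simp
    qed
    then show "(if K a = L b then 1 else 0 :: 'a) = 0" by simp
  qed
  show "nonneg (det (mat r r (\<lambda>(a, b). if I a = J b then 1 else 0)))"
  proof (cases "\<forall>a<r. I a = J a")
    case True
    then have "mat r r (\<lambda>(a, b). if I a = J b then 1 else 0) = (1\<^sub>m r :: 'a mat)"
      using strict_mono_on_imp_inj_on[OF J] by (intro eq_matI) (auto simp: inj_on_def)
    then show ?thesis by (simp add: nonneg_1)
  next
    case False
    define a where "a = (LEAST a. a < r \<and> I a \<noteq> J a)"
    from False have "a < r \<and> I a \<noteq> J a" unfolding a_def by (rule_tac LeastI_ex) auto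
    moreover have "I b = J b" if "b < a" for b
      using not_less_Least[OF that[unfolded a_def]] that calculation by auto
    ultimately consider "I a < J a" "a < r" "\<And>b. b < a \<Longrightarrow> I b = J b"
      | "J a < I a" "a < r" "\<And>b. b < a \<Longrightarrow> J b = I b" by fastforce
    then show ?thesis
    proof cases
      case 1
      then show ?thesis using zero[OF I J, of a] by (simp add: nonneg_0)
    next
      case 2
      have "det (mat r r (\<lambda>(a, b). if I a = J b then 1 else 0 :: 'a)) =
          det (mat r r (\<lambda>(a, b). if J a = I b then 1 else 0))"
        by (subst det_transpose_fun) (simp add: eq_commute[of "I _"])
      also have "\<dots> = 0" by (rule zero[OF J I 2(2,3,1)])
      finally show ?thesis by (simp add: nonneg_0)
    qed
  qed
qed

text \<open>A minor of the extended matrix that uses the new row \<open>e\<^sub>0\<close> vanishes unless it also uses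
  column \<open>0\<close>, in which case row and column can be deleted.\<close>

lemma totally_positive_prepend:
  assumes B: "totally_positive nonneg B"
  shows "totally_positive nonneg (\<lambda>i k. case i of 0 \<Rightarrow> (if k = 0 then 1 else 0) | Suc i' \<Rightarrow> B i' k)"
    (is "totally_positive nonneg ?B")
proof (rule totally_positiveI)
  fix r I J assume I: "strict_mono_on {..<r} (I :: nat \<Rightarrow> nat)" and J: "strict_mono_on {..<r} (J :: nat \<Rightarrow> nat)"
  let ?M = "mat r r (\<lambda>(a, b). ?B (I a) (J b))"
  show "nonneg (det ?M)"
  proof (cases r)
    case 0
    then show ?thesis by (simp add: nonneg_1)
  next
    case (Suc s)
    have Ipos: "0 < I (Suc a)" if "a < s" for a
      using strict_mono_onD[OF I, of 0 "Suc a"] that Suc by simp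
    have Jpos: "0 < J (Suc a)" if "a < s" for a
      using strict_mono_onD[OF J, of 0 "Suc a"] that Suc by simp
    consider "0 < I 0" | "I 0 = 0" "0 < J 0" | "I 0 = 0" "J 0 = 0" by auto
    then show ?thesis
    proof cases
      case 1
      then have pos: "0 < I a" if "a < r" for a using Ipos that Suc by (cases a) auto
      have "strict_mono_on {..<r} (\<lambda>a. I a - 1)"
      proof (rule strict_mono_onI)
        fix a b assume "a \<in> {..<r}" "b \<in> {..<r}" "a < b"
        then show "I a - 1 < I b - 1"
          using strict_mono_onD[OF I, of a b] pos[of a] by (simp add: diff_less_mono)
      qed
      moreover have "?B (I a) k = B (I a - 1) k" if "a < r" for a k
        using pos[OF that] by (cases "I a") auto
      then have "?M = mat r r (\<lambda>(a, b). B (I a - 1) (J b))"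
        by (intro eq_matI) auto
      ultimately show ?thesis using totally_positiveD[OF B _ J] by simp
    next
      case 2
      then have "0 < J b" if "b < r" for b using Jpos that Suc by (cases b) auto
      then have "det ?M = 0"
        by (intro det_zero_row[of 0]) (use 2 Suc in auto)
      then show ?thesis by (simp add: nonneg_0)
    next
      case 3
      have row: "?B (I (Suc a)) k = B (I (Suc a) - 1) k" if "a < s" for a k
        using Ipos[OF that] by (cases "I (Suc a)") auto
      have M: "?M \<in> carrier_mat r r" by simp
      have "det ?M = (\<Sum>j<r. ?M $$ (0, j) * cofactor ?M 0 j)"
        using Suc by (intro laplace_expansion_row[OF M]) auto
      also have "\<dots> = (\<Sum>j\<in>{0}. ?M $$ (0, j) * cofactor ?M 0 j)"
      proof (rule sum.mono_neutral_right)
        show "\<forall>j\<in>{..<r} - {0}. ?M $$ (0, j) * cofactor ?M 0 j = 0"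
        proof
          fix j assume "j \<in> {..<r} - {0}"
          then have "j < r" "0 < J j" using Jpos[of "j - 1"] Suc by auto
          then have "?M $$ (0, j) = 0" using 3 by simp
          then show "?M $$ (0, j) * cofactor ?M 0 j = 0" by simp
        qed
      qed (use Suc in auto)
      also have "\<dots> = det (mat_delete ?M 0 0)"
        using 3 Suc by (simp add: cofactor_def)
      also have "mat_delete ?M 0 0 = mat s s (\<lambda>(a, b). B (I (Suc a) - 1) (J (Suc b)))"
        using Suc row by (intro eq_matI) (auto simp: mat_delete_def)
      also have "nonneg (det \<dots>)"
      proof (rule totally_positiveD[OF B])
        show "strict_mono_on {..<s} (\<lambda>a. I (Suc a) - 1)"
        proof (rule strict_mono_onI)
          fix a b assume "a \<in> {..<s}" "b \<in> {..<s}" "a < b"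
          then show "I (Suc a) - 1 < I (Suc b) - 1"
            using strict_mono_onD[OF I, of "Suc a" "Suc b"] Ipos[of a] Suc by (simp add: diff_less_mono)
        qed
        show "strict_mono_on {..<s} (\<lambda>a. J (Suc a))"
          using Suc by (intro strict_mono_onI strict_mono_onD[OF J]) auto
      qed
      finally show ?thesis .
    qed
  qed
qed

end

section \<open>Production matrices\<close>

context nonneg_cone
begin

text \<open>As a matrix, \<open>a\<close> is the unit row \<open>e_0\<close> placed on top of the
  product of \<open>a\<close> and \<open>P\<close>. Hence one multiplication and one prepending lead
  from the first \<open>m\<close> rows to the first \<open>m + 1\<close>, with the rows not yet
  reached set to zero.\<close>

lemma totally_positive_production_rows:
  assumes P: "totally_positive nonneg P"
    and init: "\<And>k. a 0 k = (if k = 0 then 1 else 0)"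
    and step: "\<And>n k. a (Suc n) k = (\<Sum>j\<le>n. a n j * P j k)"
    and supp: "\<And>n k. n < k \<Longrightarrow> a n k = 0"
  shows "totally_positive nonneg a"
proof (rule totally_positive_row_limit[where A = "\<lambda>m n. if n < m then a n else (\<lambda>k. 0)"])
  fix m
  show "totally_positive nonneg (\<lambda>n. if n < m then a n else (\<lambda>k. 0))"
  proof (induction m)
    case 0
    show ?case by (simp add: totally_positive_zero)
  next
    case (Suc m)
    let ?A = "\<lambda>n k. if n < m then a n k else 0"
    have "totally_positive nonneg ?A"
      using Suc.IH by (rule back_subst[of "totally_positive nonneg"]) (simp add: fun_eq_iff)
    then have "totally_positive nonneg (\<lambda>n k. \<Sum>j<Suc n. ?A n j * P j k)"
      by (rule totally_positive_mult[OF _ P]) (simp add: supp)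
    then have "totally_positive nonneg (\<lambda>n k. case n of 0 \<Rightarrow> (if k = 0 then 1 else 0)
        | Suc n' \<Rightarrow> \<Sum>j<Suc n'. ?A n' j * P j k)"
      by (rule totally_positive_prepend)
    also have "(\<lambda>n k. case n of 0 \<Rightarrow> (if k = 0 then 1 else 0) | Suc n' \<Rightarrow> \<Sum>j<Suc n'. ?A n' j * P j k) =
        (\<lambda>n. if n < Suc m then a n else (\<lambda>k. 0))"
      by (auto simp: fun_eq_iff init step lessThan_Suc_atMost split: nat.split)
    finally show ?case .
  qed
qed simp

text \<open>Here \<open>q m\<close> is the first column of the \<open>m\<close>-th power of
  \<open>P\<close>, stored as a row; so it is the transposed matrix that is multiplied by
  \<open>P\<close> from the left. The sums are finite because row \<open>k\<close> of
  \<open>P\<close> ends one place to the right of the diagonal.\<close>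

lemma totally_positive_production_columns:
  assumes P: "totally_positive nonneg P" and hess: "\<And>j k. Suc j < k \<Longrightarrow> P j k = 0"
    and init: "\<And>k. q 0 k = (if k = 0 then 1 else 0)"
    and step: "\<And>m k. q (Suc m) k = (\<Sum>j\<le>Suc k. P k j * q m j)"
  shows "totally_positive nonneg q"
proof (rule totally_positive_row_limit[where A = "\<lambda>m n. if n < m then q n else (\<lambda>k. 0)"])
  fix m
  show "totally_positive nonneg (\<lambda>n. if n < m then q n else (\<lambda>k. 0))"
  proof (induction m)
    case 0
    show ?case by (simp add: totally_positive_zero)
  next
    case (Suc m)
    let ?A = "\<lambda>n k. if n < m then q n k else 0"
    have "totally_positive nonneg ?A"
      using Suc.IH by (rule back_subst[of "totally_positive nonneg"]) (simp add: fun_eq_iff)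
    then have "totally_positive nonneg (\<lambda>k n. ?A n k)"
      by (rule totally_positive_transpose)
    then have "totally_positive nonneg (\<lambda>k n. \<Sum>j<Suc (Suc k). P k j * ?A n j)"
      by (rule totally_positive_mult[OF P]) (simp add: hess)
    then have "totally_positive nonneg (\<lambda>n k. \<Sum>j<Suc (Suc k). P k j * ?A n j)"
      by (rule totally_positive_transpose)
    then have "totally_positive nonneg (\<lambda>n k. case n of 0 \<Rightarrow> (if k = 0 then 1 else 0)
        | Suc n' \<Rightarrow> \<Sum>j<Suc (Suc k). P k j * ?A n' j)"
      by (rule totally_positive_prepend)
    also have "(\<lambda>n k. case n of 0 \<Rightarrow> (if k = 0 then 1 else 0)
        | Suc n' \<Rightarrow> \<Sum>j<Suc (Suc k). P k j * ?A n' j) =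
        (\<lambda>n. if n < Suc m then q n else (\<lambda>k. 0))"
      by (auto simp: fun_eq_iff init step lessThan_Suc_atMost split: nat.split)
    finally show ?case .
  qed
qed simp

text \<open>With \<open>a n\<close> the top row and \<open>q n\<close> the first column of the \<open>n\<close>-th power of \<open>P\<close>,
  the \<open>(n, m)\<close> entry of the Hankel matrix is the corner entry of \<open>P\<close> to the power \<open>n + m\<close>,
  that is, the product of row \<open>a n\<close> and column \<open>q m\<close>.\<close>

lemma Hankel_totally_positive_production:
  assumes P: "totally_positive nonneg P" and hess: "\<And>j k. Suc j < k \<Longrightarrow> P j k = 0"
    and init: "\<And>k. a 0 k = (if k = 0 then 1 else 0)"
    and step: "\<And>n k. a (Suc n) k = (\<Sum>j\<le>n. a n j * P j k)"
    and supp: "\<And>n k. n < k \<Longrightarrow> a n k = 0"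
  shows "Hankel_totally_positive nonneg (\<lambda>n. a n 0)"
proof -
  define q where "q = rec_nat (\<lambda>k. if k = 0 then 1 else 0) (\<lambda>_ r k. \<Sum>j\<le>Suc k. P k j * r j)"
  have q0: "q 0 k = (if k = 0 then 1 else 0)" for k by (simp add: q_def)
  have qS: "q (Suc m) k = (\<Sum>j\<le>Suc k. P k j * q m j)" for m k by (simp add: q_def)
  have "a (n + m) 0 = (\<Sum>j<Suc n. a n j * q m j)" for n m
  proof (induction m arbitrary: n)
    case 0
    have "(\<Sum>j<Suc n. a n j * q 0 j) = (\<Sum>j\<in>{0}. a n j * q 0 j)"
      by (rule sum.mono_neutral_right) (auto simp: q0)
    then show ?case by (simp add: q0)
  next
    case (Suc m)
    have "a (n + Suc m) 0 = (\<Sum>j\<le>Suc n. a (Suc n) j * q m j)"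
      using Suc.IH[of "Suc n"] by (simp only: add_Suc_right add_Suc lessThan_Suc_atMost)
    also have "\<dots> = (\<Sum>j\<le>Suc n. \<Sum>i\<le>n. a n i * (P i j * q m j))"
      by (simp only: step sum_distrib_right mult.assoc)
    also have "\<dots> = (\<Sum>i\<le>n. \<Sum>j\<le>Suc n. a n i * (P i j * q m j))"
      by (rule sum.swap)
    also have "\<dots> = (\<Sum>i\<le>n. a n i * (\<Sum>j\<le>Suc i. P i j * q m j))"
    proof (intro sum.cong refl)
      fix i assume "i \<in> {..n}"
      then have "(\<Sum>j\<le>Suc n. P i j * q m j) = (\<Sum>j\<le>Suc i. P i j * q m j)"
        by (intro sum.mono_neutral_right) (auto simp: hess)
      then show "(\<Sum>j\<le>Suc n. a n i * (P i j * q m j)) = a n i * (\<Sum>j\<le>Suc i. P i j * q m j)"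
        by (simp only: sum_distrib_left[symmetric])
    qed
    finally show ?case by (simp only: qS lessThan_Suc_atMost)
  qed
  moreover have "totally_positive nonneg (\<lambda>n m. \<Sum>j<Suc n. a n j * q m j)"
    using totally_positive_production_rows[OF P init step supp]
      totally_positive_transpose[OF totally_positive_production_columns[OF P hess q0 qS]]
    by (rule totally_positive_mult) (auto intro: supp)
  ultimately show ?thesis
    unfolding Hankel_totally_positive_def by simp
qed

end

section \<open>The matrices of multiplication by x + X, of X -> X + z and of (1 - y D)^(-1)\<close>

lemma linear_times_monom: "[:x, 1:] * monom c i = smult c (monom x i + monom 1 (Suc i))"
  by (simp add: smult_add_right smult_monom monom_Suc ac_simps)

lemma degree_linear_power_le: "degree ([:c, 1:] ^ n) \<le> n"
  by (rule order_trans[OF degree_power_le]) simp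

text \<open>The image of X^n under (1 - y D)^(-1), that is, the sum of y^j n (n - 1) ... (n - j + 1)
  X^(n - j) over j \<le> n. The recursive form expresses each row by the preceding one, which is
  what row operations need.\<close>

primrec inverse_minus_pderiv :: "'a::comm_ring_1 \<Rightarrow> nat \<Rightarrow> 'a poly" where
  "inverse_minus_pderiv y 0 = 1"
| "inverse_minus_pderiv y (Suc n) = smult (of_nat (Suc n) * y) (inverse_minus_pderiv y n) + monom 1 (Suc n)"

text \<open>The two claims are proved together because they alternate: the first at \<open>n\<close>
  gives the second at \<open>Suc n\<close>, which in turn gives the first at
  \<open>Suc n\<close>.\<close>

lemma pderiv_inverse_minus_pderiv:
  fixes y :: "'a::idom"
  shows "pderiv (inverse_minus_pderiv y (Suc n)) = smult (of_nat (Suc n)) (inverse_minus_pderiv y n) \<and>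
   inverse_minus_pderiv y n - smult y (pderiv (inverse_minus_pderiv y n)) = monom 1 n"
proof (induction n)
  case 0
  show ?case by (simp add: pderiv_add pderiv_smult pderiv_monom monom_0 pderiv_1 one_pCons)
next
  case (Suc n)
  let ?p = "inverse_minus_pderiv y"
  have *: "?p (Suc n) - smult y (pderiv (?p (Suc n))) = monom 1 (Suc n)"
    unfolding conjunct1[OF Suc] by (simp add: mult.commute)
  have "pderiv (?p (Suc (Suc n))) = smult (of_nat (Suc (Suc n))) (smult y (pderiv (?p (Suc n))) + monom 1 (Suc n))"
    by (subst inverse_minus_pderiv.simps(2))
      (simp add: pderiv_add pderiv_smult pderiv_monom smult_add_right smult_monom
        del: of_nat_Suc inverse_minus_pderiv.simps)
  also have "smult y (pderiv (?p (Suc n))) + monom 1 (Suc n) = ?p (Suc n)"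
    using * by (simp only: algebra_simps)
  finally show ?case using * by simp
qed

text \<open>Differentiation lowers the degree, so the leading coefficient of \<open>p\<close>
  survives. The resulting injectivity of 1 - y D lets polynomials be identified by their
  images.\<close>

lemma minus_pderiv_eq_0_imp:
  assumes "p - smult y (pderiv p) = (0 :: 'a::idom poly)"
  shows "p = 0"
proof -
  have "coeff (p - smult y (pderiv p)) (degree p) = lead_coeff p"
    by (simp add: coeff_pderiv coeff_eq_0)
  then show ?thesis using assms by simp
qed

context nonneg_cone
begin

text \<open>This is the matrix of multiplication by x + X. It arises from the identity matrix from
  the top down: when row \<open>m\<close> is replaced by \<open>x\<close> times itself plus row
  \<open>m + 1\<close>, the latter is still a unit vector.\<close>

lemma totally_positive_bidiagonal:
  assumes "nonneg x"
  shows "totally_positive nonneg (\<lambda>i l. coeff (monom x i + monom 1 (Suc i)) l)"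
proof (rule totally_positive_row_limit[where A = "\<lambda>m i l. if i < m then coeff (monom x i + monom 1 (Suc i)) l else if i = l then 1 else 0"])
  fix m
  let ?A = "\<lambda>m i l. if i < m then coeff (monom x i + monom 1 (Suc i)) l else if i = l then 1 else 0"
  show "totally_positive nonneg (?A m)"
  proof (induction m)
    case 0
    show ?case using totally_positive_id by simp
  next
    case (Suc m)
    have "?A (Suc m) = (?A m)(m := \<lambda>k. x * ?A m m k + 1 * ?A m (Suc m) k)"
      by (auto simp: fun_eq_iff)
    then show ?case
      using totally_positive_row_op[OF Suc assms nonneg_1, of "Suc m" m] by simp
  qed
qed simp

text \<open>Row \<open>n + 1\<close> is z + X times row \<open>n\<close>, so the matrix of the
  substitution X -> X + z has a bidiagonal production matrix.\<close>

lemma totally_positive_binomial: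
  assumes "nonneg z"
  shows "totally_positive nonneg (\<lambda>n k. coeff ([:z, 1:] ^ n) k)"
proof (rule totally_positive_production_rows[OF totally_positive_bidiagonal[OF assms]])
  fix n k
  have p: "[:z, 1:] ^ n = (\<Sum>j\<le>n. monom (coeff ([:z, 1:] ^ n) j) j)"
    by (rule poly_as_sum_of_monoms'[symmetric, OF degree_linear_power_le])
  have "[:z, 1:] ^ Suc n = [:z, 1:] * (\<Sum>j\<le>n. monom (coeff ([:z, 1:] ^ n) j) j)"
    using p by simp
  also have "\<dots> = (\<Sum>j\<le>n. smult (coeff ([:z, 1:] ^ n) j) (monom z j + monom 1 (Suc j)))"
    by (simp only: sum_distrib_left linear_times_monom)
  finally show "coeff ([:z, 1:] ^ Suc n) k =
      (\<Sum>j\<le>n. coeff ([:z, 1:] ^ n) j * coeff (monom z j + monom 1 (Suc j)) k)"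
    by (simp only: coeff_sum coeff_smult)
next
  fix n k :: nat assume "n < k"
  then show "coeff ([:z, 1:] ^ n) k = 0"
    using degree_linear_power_le[of z n] by (intro coeff_eq_0) simp
qed simp

text \<open>Row \<open>m + 1\<close> is a unit vector plus \<open>(m + 1) * y\<close> times the
  finished row \<open>m\<close>, an adjacent row operation applied to the identity matrix.\<close>

lemma totally_positive_inverse_minus_pderiv:
  assumes "nonneg y"
  shows "totally_positive nonneg (\<lambda>n k. coeff (inverse_minus_pderiv y n) k)"
\<comment> \<open>The bound is \<open>Suc m\<close> because row \<open>0\<close> is the polynomial
  1, already a unit vector.\<close>
proof (rule totally_positive_row_limit[where A = "\<lambda>m n k. if n < Suc m then coeff (inverse_minus_pderiv y n) k else if n = k then 1 else 0"])
  fix m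
  let ?A = "\<lambda>m n k. if n < Suc m then coeff (inverse_minus_pderiv y n) k else if n = k then 1 else 0"
  show "totally_positive nonneg (?A m)"
  proof (induction m)
    case 0
    have "?A 0 = (\<lambda>i j. if i = j then 1 else 0)" by (auto simp: fun_eq_iff)
    then show ?case using totally_positive_id by simp
  next
    case (Suc m)
    have "?A (Suc m) = (?A m)(Suc m := \<lambda>k. 1 * ?A m (Suc m) k + (of_nat (Suc m) * y) * ?A m m k)"
      by (auto simp: fun_eq_iff)
    then show ?case
      using totally_positive_row_op[OF Suc nonneg_1 nonneg_mult[OF nonneg_of_nat assms], of m "Suc m" "Suc m"]
      by simp
  qed
qed simp

end

text \<open>With x = 0 the coefficients of \<open>A n\<close> are a matrix row of part (a); with x
  an indeterminate the constant terms are the sequence of part (b). The recurrence gives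
  \<open>A (Suc n)\<close> only implicitly, so even the bound on its degree has to be extracted from
  it.\<close>

lemma
  fixes A :: "nat \<Rightarrow> 'a::idom poly"
  assumes cone: "nonneg_cone nonneg"
    and nonneg: "nonneg x" "nonneg y" "nonneg z"
    and A0: "A 0 = 1"
    and AS: "\<And>n. A (Suc n) - smult y (pderiv (A (Suc n))) = [:x, 1:] * pcompose (A n) [:z, 1:]"
  shows totally_positive_coeff_of_recurrence: "totally_positive nonneg (\<lambda>n k. coeff (A n) k)"
    and Hankel_totally_positive_of_recurrence: "Hankel_totally_positive nonneg (\<lambda>n. coeff (A n) 0)"
proof -
  interpret nonneg_cone nonneg by (rule cone)
  let ?M = "inverse_minus_pderiv y"
  \<comment> \<open>The image of X^j under the substitution followed by the multiplication;
    \<open>P j\<close> is its preimage under 1 - y D.\<close>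
  let ?r = "\<lambda>j. [:x, 1:] * [:z, 1:] ^ j"
  define P where "P j = (\<Sum>l<Suc (Suc j). smult (coeff (?r j) l) (?M l))" for j
  have deg_M: "degree (?M l) \<le> l" for l
    by (induction l) (auto intro!: degree_add_le order_trans[OF degree_smult_le] degree_monom_le)
  have deg_r: "degree (?r j) \<le> Suc j" for j
    using degree_linear_power_le[of z j] degree_mult_le[of "[:x, 1:]" "[:z, 1:] ^ j"] by simp
  have deg_P: "degree (P j) \<le> Suc j" for j
    unfolding P_def using deg_M
    by (intro degree_sum_le) (auto intro!: order_trans[OF degree_smult_le] order_trans[OF deg_M])
  have minus_P: "P j - smult y (pderiv (P j)) = ?r j" for j
  proof -
    have "P j - smult y (pderiv (P j)) =
        (\<Sum>l<Suc (Suc j). smult (coeff (?r j) l) (?M l - smult y (pderiv (?M l))))"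
      unfolding P_def
      by (simp only: pderiv_sum pderiv_smult smult_sum2 sum_subtractf[symmetric] smult_diff_right
          smult_smult mult.commute)
    also have "\<dots> = (\<Sum>l\<le>Suc j. monom (coeff (?r j) l) l)"
      using pderiv_inverse_minus_pderiv[of y] by (simp only: smult_monom lessThan_Suc_atMost mult_1_right)
    also have "\<dots> = ?r j" by (rule poly_as_sum_of_monoms'[OF deg_r])
    finally show ?thesis .
  qed
  have tp_r: "totally_positive nonneg (\<lambda>j l. coeff (?r j) l)"
  proof -
    have "?r j = (\<Sum>i<Suc j. smult (coeff ([:z, 1:] ^ j) i) (monom x i + monom 1 (Suc i)))" for j
    proof -
      have "[:z, 1:] ^ j = (\<Sum>i<Suc j. monom (coeff ([:z, 1:] ^ j) i) i)"
        using poly_as_sum_of_monoms'[OF degree_linear_power_le, of z j] by (simp only: lessThan_Suc_atMost)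
      then have "?r j = [:x, 1:] * (\<Sum>i<Suc j. monom (coeff ([:z, 1:] ^ j) i) i)"
        by (rule arg_cong)
      then show ?thesis by (simp only: sum_distrib_left linear_times_monom)
    qed
    then have "coeff (?r j) l = (\<Sum>i<Suc j. coeff ([:z, 1:] ^ j) i * coeff (monom x i + monom 1 (Suc i)) l)" for j l
      by (simp only: coeff_sum coeff_smult)
    moreover have "coeff ([:z, 1:] ^ j) l = 0" if "Suc j \<le> l" for j l
      using degree_linear_power_le[of z j] that by (intro coeff_eq_0) simp
    ultimately show ?thesis
      using totally_positive_mult[OF totally_positive_binomial[OF nonneg(3)]
          totally_positive_bidiagonal[OF nonneg(1)], of Suc]
      by presburger
  qed
  have tp_P: "totally_positive nonneg (\<lambda>j k. coeff (P j) k)"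
    unfolding P_def coeff_sum coeff_smult
    using tp_r totally_positive_inverse_minus_pderiv[OF nonneg(2)]
  proof (rule totally_positive_mult)
    fix j l :: nat assume "Suc (Suc j) \<le> l"
    then show "coeff (?r j) l = 0" using deg_r[of j] by (intro coeff_eq_0) simp
  qed
  \<comment> \<open>Both sides have the same image under 1 - y D. The degree bound is a premise here
    since it is obtained afterwards by an induction that uses this very step.\<close>
  have A_step: "A (Suc n) = (\<Sum>j\<le>n. smult (coeff (A n) j) (P j))" if deg: "degree (A n) \<le> n" for n
  proof -
    let ?C = "\<Sum>j\<le>n. smult (coeff (A n) j) (P j)"
    have "?C - smult y (pderiv ?C) = (\<Sum>j\<le>n. smult (coeff (A n) j) (P j - smult y (pderiv (P j))))"
      by (simp only: pderiv_sum pderiv_smult smult_sum2 sum_subtractf[symmetric] smult_diff_right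
          smult_smult mult.commute)
    also have "\<dots> = [:x, 1:] * (\<Sum>j\<le>n. smult (coeff (A n) j) ([:z, 1:] ^ j))"
      by (simp only: minus_P sum_distrib_left mult_smult_right)
    also have "(\<Sum>j\<le>n. smult (coeff (A n) j) ([:z, 1:] ^ j)) = pcompose (A n) [:z, 1:]"
      by (subst (2) poly_as_sum_of_monoms'[OF deg, symmetric])
        (simp add: pcompose_sum monom_altdef pcompose_smult pcompose_pCons pcompose_hom.hom_power)
    finally have C: "?C - smult y (pderiv ?C) = [:x, 1:] * pcompose (A n) [:z, 1:]" .
    have "(A (Suc n) - ?C) - smult y (pderiv (A (Suc n) - ?C)) =
        (A (Suc n) - smult y (pderiv (A (Suc n)))) - (?C - smult y (pderiv ?C))"
      by (simp add: pderiv_diff smult_diff_right)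
    also have "\<dots> = 0" unfolding AS C by simp
    finally have "(A (Suc n) - ?C) - smult y (pderiv (A (Suc n) - ?C)) = 0" .
    then show ?thesis using minus_pderiv_eq_0_imp by force
  qed
  have deg: "degree (A n) \<le> n" for n
  proof (induction n)
    case (Suc n)
    show ?case unfolding A_step[OF Suc]
      by (intro degree_sum_le) (auto intro!: order_trans[OF degree_smult_le] order_trans[OF deg_P])
  qed (simp add: A0)
  have supp: "coeff (A n) k = 0" if "n < k" for n k
    using deg[of n] that by (intro coeff_eq_0) simp
  have step: "coeff (A (Suc n)) k = (\<Sum>j\<le>n. coeff (A n) j * coeff (P j) k)" for n k
    using A_step[OF deg] by (simp add: coeff_sum)
  have init: "coeff (A 0) k = (if k = 0 then 1 else 0)" for k by (simp add: A0)
  show "totally_positive nonneg (\<lambda>n k. coeff (A n) k)"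
    using tp_P init step supp by (rule totally_positive_production_rows)
  have hess: "coeff (P j) k = 0" if "Suc j < k" for j k
    using deg_P[of j] that by (intro coeff_eq_0) simp
  show "Hankel_totally_positive nonneg (\<lambda>n. coeff (A n) 0)"
    using tp_P hess init step supp by (rule Hankel_totally_positive_production)
qed

section \<open>From the recurrence to total positivity\<close>

text \<open>One application adjoins one indeterminate: two lead from the integers to
  \<open>coeffs_nonneg_yz\<close>, a third to \<open>coeffs_nonneg_xyz\<close>.\<close>

lemma (in nonneg_cone) nonneg_cone_coeff: "nonneg_cone (\<lambda>p. \<forall>i. nonneg (coeff p i))"
proof
  fix p q :: "'a poly"
  assume "\<forall>i. nonneg (coeff p i)" "\<forall>i. nonneg (coeff q i)"
  then show "\<forall>i. nonneg (coeff (p * q) i)"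
    by (auto simp: coeff_mult intro!: nonneg_sum nonneg_mult)
qed (auto simp: coeff_1 intro: nonneg_0 nonneg_1 nonneg_add)

lemma nonneg_cone_yz: "nonneg_cone coeffs_nonneg_yz"
proof -
  have "nonneg_cone ((\<le>) (0 :: int))" by standard auto
  then show ?thesis
    unfolding coeffs_nonneg_yz_def by (intro nonneg_cone.nonneg_cone_coeff)
qed

lemma nonneg_cone_xyz: "nonneg_cone coeffs_nonneg_xyz"
  using nonneg_cone.nonneg_cone_coeff[OF nonneg_cone_yz]
  unfolding coeffs_nonneg_yz_def coeffs_nonneg_xyz_def .

text \<open>Everything is expanded in powers of x + X, whose derivative in X is 1, so one
  computation covers every x. On the left the term of exponent 0 cancels by \<open>rec_0\<close>,
  which leaves a factor x + X; on the right the binomial theorem assembles the powers of x + X +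
  z.\<close>

lemma row_polynomial_recurrence:
  fixes t :: "nat \<Rightarrow> nat \<Rightarrow> 'a::idom" and x y z :: 'a
  assumes supp: "\<And>n k. n < k \<Longrightarrow> t n k = 0"
    and rec_0: "\<And>n. t (Suc n) 0 = y * t (Suc n) 1"
    and rec_Suc: "\<And>n k. t (Suc n) (Suc k) = of_nat (Suc (Suc k)) * y * t (Suc n) (Suc (Suc k)) +
      (\<Sum>j\<le>n. of_nat (j choose k) * z ^ (j - k) * t n j)"
  defines "A \<equiv> \<lambda>n. \<Sum>k\<le>n. smult (t n k) ([:x, 1:] ^ k)"
  shows "A (Suc n) - smult y (pderiv (A (Suc n))) = [:x, 1:] * pcompose (A n) [:z, 1:]"
proof -
  let ?L = "[:x, 1:]"
  have [simp]: "pderiv ?L = 1" by (simp add: pderiv_pCons one_pCons)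
  have pderiv_pow: "pderiv (?L ^ k) = smult (of_nat k) (?L ^ (k - 1))" for k
    by (simp add: pderiv_power del: pCons_eq_iff)
  have "pderiv (A (Suc n)) = (\<Sum>k\<le>Suc n. smult (of_nat k * t (Suc n) k) (?L ^ (k - 1)))"
    unfolding A_def pderiv_sum pderiv_smult pderiv_pow smult_smult by (simp only: mult.commute)
  also have "\<dots> = (\<Sum>k\<le>n. smult (of_nat (Suc k) * t (Suc n) (Suc k)) (?L ^ k))"
    by (subst sum.atMost_Suc_shift) simp
  \<comment> \<open>The added term \<open>k = Suc n\<close> contains an entry above the diagonal,
    which is 0; it makes the ranges of the two sums agree.\<close>
  also have "\<dots> = (\<Sum>k\<le>Suc n. smult (of_nat (Suc k) * t (Suc n) (Suc k)) (?L ^ k))"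
    by (simp add: supp)
  finally have "A (Suc n) - smult y (pderiv (A (Suc n))) =
      (\<Sum>k\<le>Suc n. smult (t (Suc n) k - of_nat (Suc k) * y * t (Suc n) (Suc k)) (?L ^ k))"
    by (simp only: A_def smult_sum2 smult_smult smult_diff_left sum_subtractf ac_simps)
  also have "\<dots> = (\<Sum>k\<le>n. smult (t (Suc n) (Suc k) - of_nat (Suc (Suc k)) * y * t (Suc n) (Suc (Suc k))) (?L ^ Suc k))"
  proof -
    have "t (Suc n) 0 - of_nat (Suc 0) * y * t (Suc n) (Suc 0) = 0" by (simp add: rec_0)
    then show ?thesis by (simp only: sum.atMost_Suc_shift smult_0_left add_0_left)
  qed
  also have "\<dots> = (\<Sum>k\<le>n. smult (\<Sum>j\<le>n. of_nat (j choose k) * z ^ (j - k) * t n j) (?L ^ Suc k))"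
  proof -
    have "t (Suc n) (Suc k) - of_nat (Suc (Suc k)) * y * t (Suc n) (Suc (Suc k)) =
        (\<Sum>j\<le>n. of_nat (j choose k) * z ^ (j - k) * t n j)" for k
      by (subst rec_Suc) (rule add_diff_cancel_left')
    then show ?thesis by (simp only:)
  qed
  also have "\<dots> = (\<Sum>k\<le>n. \<Sum>j\<le>n. smult (of_nat (j choose k) * z ^ (j - k) * t n j) (?L ^ Suc k))"
    by (simp only: smult_sum)
  also have "\<dots> = (\<Sum>j\<le>n. \<Sum>k\<le>n. smult (of_nat (j choose k) * z ^ (j - k) * t n j) (?L ^ Suc k))"
    by (rule sum.swap)
  also have "\<dots> = (\<Sum>j\<le>n. ?L * smult (t n j) ((?L + [:z:]) ^ j))"
  proof (intro sum.cong refl)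
    fix j assume j: "j \<in> {..n}"
    have "(\<Sum>k\<le>n. smult (of_nat (j choose k) * z ^ (j - k) * t n j) (?L ^ Suc k)) =
        (\<Sum>k\<le>j. smult (of_nat (j choose k) * z ^ (j - k) * t n j) (?L ^ Suc k))"
      using j by (intro sum.mono_neutral_right) (auto simp: not_le binomial_eq_0)
    also have "\<dots> = (\<Sum>k\<le>j. ?L * smult (t n j) (of_nat (j choose k) * ?L ^ k * [:z:] ^ (j - k)))"
    proof (intro sum.cong refl)
      fix k
      have "of_nat (j choose k) * ?L ^ k * [:z:] ^ (j - k) = smult (of_nat (j choose k) * z ^ (j - k)) (?L ^ k)"
        by (simp add: of_nat_poly poly_const_pow mult.commute)
      then show "smult (of_nat (j choose k) * z ^ (j - k) * t n j) (?L ^ Suc k) =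
          ?L * smult (t n j) (of_nat (j choose k) * ?L ^ k * [:z:] ^ (j - k))"
        by (simp only: smult_smult mult_smult_right power_Suc) (simp only: ac_simps)
    qed
    finally show "(\<Sum>k\<le>n. smult (of_nat (j choose k) * z ^ (j - k) * t n j) (?L ^ Suc k)) =
        ?L * smult (t n j) ((?L + [:z:]) ^ j)"
      by (simp only: binomial_ring sum_distrib_left smult_sum2)
  qed
  also have "\<dots> = ?L * pcompose (A n) [:z, 1:]"
  proof -
    have "pcompose ?L [:z, 1:] = ?L + [:z:]" by (simp add: pcompose_pCons)
    then show ?thesis
      unfolding A_def by (simp add: pcompose_sum pcompose_smult pcompose_hom.hom_power sum_distrib_left
        del: mult_pCons_left)
  qed
  finally show ?thesis .
qed

text \<open>The four assumptions are all that is used about trees; the combinatorial part that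
  follows establishes them.\<close>

lemma
  assumes init: "\<And>k. t_poly 0 k = (if k = 0 then 1 else 0)"
    and supp: "\<And>n k. n < k \<Longrightarrow> t_poly n k = 0"
    and rec_0: "\<And>n. t_poly (Suc n) 0 = y_var * t_poly (Suc n) 1"
    and rec_Suc: "\<And>n k. t_poly (Suc n) (Suc k) = of_nat (Suc (Suc k)) * y_var * t_poly (Suc n) (Suc (Suc k)) +
      (\<Sum>j\<le>n. of_nat (j choose k) * z_var ^ (j - k) * t_poly n j)"
  shows unit_lower_triangular_of_recurrence: "unit_lower_triangular t_poly"
    and totally_positive_t_poly_of_recurrence: "totally_positive coeffs_nonneg_yz t_poly"
    and Hankel_totally_positive_T_poly_of_recurrence: "Hankel_totally_positive coeffs_nonneg_xyz T_poly"
proof -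
  have "t_poly n n = 1" for n
  proof (induction n)
    case (Suc n)
    have "(\<Sum>j\<le>n. of_nat (j choose n) * z_var ^ (j - n) * t_poly n j) =
        (\<Sum>j\<in>{n}. of_nat (j choose n) * z_var ^ (j - n) * t_poly n j)"
      by (intro sum.mono_neutral_right) auto
    then show ?case using Suc rec_Suc[of n n] by (simp add: supp)
  qed (simp add: init)
  then show "unit_lower_triangular t_poly"
    by (simp add: unit_lower_triangular_def supp)
  have yz: "coeffs_nonneg_yz 0" "coeffs_nonneg_yz y_var" "coeffs_nonneg_yz z_var"
    by (auto simp: coeffs_nonneg_yz_def y_var_def z_var_def coeff_pCons split: nat.split)
  \<comment> \<open>With x = 0 this is the row polynomial itself, so its coefficients are the matrix
    entries.\<close>
  define A where "A n = (\<Sum>k\<le>n. smult (t_poly n k) ([:0, 1:] ^ k))" for n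
  have "totally_positive coeffs_nonneg_yz (\<lambda>n k. coeff (A n) k)"
  proof (rule totally_positive_coeff_of_recurrence[OF nonneg_cone_yz yz])
    show "A 0 = 1" by (simp add: A_def init)
    show "A (Suc n) - smult y_var (pderiv (A (Suc n))) = [:0, 1:] * pcompose (A n) [:z_var, 1:]" for n
      unfolding A_def by (rule row_polynomial_recurrence[OF supp rec_0 rec_Suc])
  qed
  moreover have "coeff (A n) k = t_poly n k" for n k
  proof -
    have "coeff (A n) k = (\<Sum>j\<le>n. if j = k then t_poly n j else 0)"
      by (simp add: A_def coeff_sum monom_altdef[symmetric] del: coeff_smult)
    then show ?thesis by (simp add: supp)
  qed
  ultimately show "totally_positive coeffs_nonneg_yz t_poly" by simp

  have xyz: "coeffs_nonneg_xyz x_var" "coeffs_nonneg_xyz [:y_var:]" "coeffs_nonneg_xyz [:z_var:]"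
    using yz(2,3)
    by (auto simp: coeffs_nonneg_yz_def coeffs_nonneg_xyz_def x_var_def coeff_pCons split: nat.split)
  \<comment> \<open>Now \<open>x_var\<close> is an element of the coefficient ring, and one more
    polynomial layer carries the auxiliary variable X; setting X to 0 gives back
    \<open>T_poly n\<close>.\<close>
  define B where "B n = (\<Sum>k\<le>n. smult [:t_poly n k:] ([:x_var, 1:] ^ k))" for n
  have const: "[:a + b:] = [:a:] + [:b:]" "[:a * b:] = [:a:] * [:b:]" "[:a ^ m:] = [:a:] ^ m"
    "[:of_nat m:] = of_nat m" for m and a b :: "int poly poly"
    by (simp_all add: of_nat_poly poly_const_pow)
  have const_sum: "[:sum f S:] = (\<Sum>s\<in>S. [:f s:])" for f :: "nat \<Rightarrow> int poly poly" and S
    by (rule poly_eqI) (simp add: coeff_sum coeff_pCons split: nat.split)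
  have "Hankel_totally_positive coeffs_nonneg_xyz (\<lambda>n. coeff (B n) 0)"
  proof (rule Hankel_totally_positive_of_recurrence[OF nonneg_cone_xyz xyz])
    show "B 0 = 1" by (simp add: B_def init one_pCons)
    have r0: "[:t_poly (Suc n) 0:] = [:y_var:] * [:t_poly (Suc n) 1:]" for n
      by (simp add: rec_0)
    have rS: "[:t_poly (Suc n) (Suc k):] = of_nat (Suc (Suc k)) * [:y_var:] * [:t_poly (Suc n) (Suc (Suc k)):] +
      (\<Sum>j\<le>n. of_nat (j choose k) * [:z_var:] ^ (j - k) * [:t_poly n j:])" for n k
      by (subst rec_Suc) (simp only: const const_sum)
    show "B (Suc n) - smult [:y_var:] (pderiv (B (Suc n))) = [:x_var, 1:] * pcompose (B n) [:[:z_var:], 1:]" for n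
      unfolding B_def
      by (rule row_polynomial_recurrence[where t = "\<lambda>n k. [:t_poly n k:]", OF _ r0 rS]) (simp add: supp)
  qed
  moreover have "coeff (B n) 0 = T_poly n" for n
    by (simp add: B_def T_poly_def coeff_sum coeff_0_power atMost_atLeast0)
  ultimately show "Hankel_totally_positive coeffs_nonneg_xyz T_poly" by simp
qed

section \<open>Parent functions\<close>

text \<open>A rooted forest on \<open>{1..n}\<close> is encoded by its parent function, with \<open>0\<close> as the parent of
  the roots and as the value outside of \<open>{1..n}\<close>.\<close>

abbreviation anc :: "(nat \<Rightarrow> nat) \<Rightarrow> nat \<Rightarrow> nat \<Rightarrow> bool" where
  "anc p \<equiv> (\<lambda>u v. p u = v)\<^sup>*\<^sup>*"

text \<open>Acyclicity is expressed by the reachability of the phantom root \<open>0\<close>, which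
  at the same time provides induction along the way up from a vertex.\<close>

definition forest :: "nat \<Rightarrow> (nat \<Rightarrow> nat) \<Rightarrow> bool" where
  "forest n p \<longleftrightarrow> (\<forall>v. v \<notin> {1..n} \<longrightarrow> p v = 0) \<and> (\<forall>v. p v \<le> n) \<and> (\<forall>v. anc p v 0)"

definition roots :: "nat \<Rightarrow> (nat \<Rightarrow> nat) \<Rightarrow> nat set" where
  "roots n p = {v \<in> {1..n}. p v = 0}"

definition parent_tree :: "nat \<Rightarrow> (nat \<Rightarrow> nat) \<Rightarrow> bool" where
  "parent_tree n p \<longleftrightarrow> forest n p \<and> card (roots n p) = 1"

abbreviation kids :: "(nat \<Rightarrow> nat) \<Rightarrow> nat \<Rightarrow> nat set" where
  "kids p v \<equiv> {w. p w = v}"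

text \<open>An edge is represented by its child. A root fails the condition by itself, as no natural
  number is less than \<open>0\<close>.\<close>

definition improper_children :: "(nat \<Rightarrow> nat) \<Rightarrow> nat set" where
  "improper_children p = {v. \<exists>l. anc p l v \<and> l < p v}"

section \<open>Ancestors in a forest\<close>

lemma anc_iff: "anc p u v \<longleftrightarrow> u = v \<or> anc p (p u) v"
proof
  assume "anc p u v"
  then show "u = v \<or> anc p (p u) v" by (cases rule: converse_rtranclpE) simp_all
next
  assume "u = v \<or> anc p (p u) v"
  then show "anc p u v"
  proof
    assume "anc p (p u) v"
    then show ?thesis by (rule converse_rtranclp_into_rtranclp[rotated]) simp
  qed simp
qed

lemma anc_parent: "anc p u (p u)"
  by (simp add: r_into_rtranclp)

lemma forest_outside: "forest n p \<Longrightarrow> v \<notin> {1..n} \<Longrightarrow> p v = 0"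
  by (simp add: forest_def)

lemma forest_0: "forest n p \<Longrightarrow> p 0 = 0"
  by (simp add: forest_outside)

lemma forest_vertex: "forest n p \<Longrightarrow> p v \<noteq> 0 \<Longrightarrow> v \<in> {1..n} \<and> p v \<in> {1..n}"
  unfolding forest_def by (metis atLeastAtMost_iff less_one not_less)

lemma forest_anc_0: "forest n p \<Longrightarrow> anc p v 0"
  by (simp add: forest_def)

lemma anc_from_0:
  assumes "forest n p" "anc p 0 v"
  shows "v = 0"
  using assms(2) by (induction rule: rtranclp_induct) (simp_all add: forest_0[OF assms(1)])

text \<open>A cycle through \<open>v\<close> also passes through its parent, so by induction along
  the way up it would pass through \<open>0\<close>, from which only \<open>0\<close> can be
  reached.\<close>

lemma forest_acyclic:
  assumes "forest n p" "anc p (p v) v"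
  shows "v = 0"
  using forest_anc_0[OF assms(1), of v] assms(2)
proof (induction rule: converse_rtranclp_induct)
  case (step v w)
  have "anc p (p w) w"
    using step.prems step.hyps(1) anc_iff[of p "p v" v] anc_iff[of p w w]
    by (metis anc_parent rtranclp_trans)
  then have "w = 0" by (rule step.IH)
  then show ?case using step.prems step.hyps(1) anc_from_0[OF assms(1)] by simp
qed simp

lemma anc_linear:
  assumes "anc p u v" "anc p u w"
  shows "anc p v w \<or> anc p w v"
  using assms(1)
proof (induction rule: rtranclp_induct)
  case (step x y)
  from step.IH show ?case
  proof
    assume "anc p x w"
    then show ?thesis using anc_iff[of p x w] step.hyps(2) anc_parent[of p x] by auto
  next
    assume "anc p w x"
    then show ?thesis using step.hyps(2) by (auto intro: rtranclp.rtrancl_into_rtrancl)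
  qed
qed (simp add: assms(2))

text \<open>Follow the way up from \<open>l\<close> to the first vertex \<open>u\<close> at which
  the two parent functions disagree: up to there it is a way in both. This compares ancestors before
  and after each of the surgeries below.\<close>

lemma anc_transfer:
  assumes "anc p l v"
  shows "anc q l v \<or> (\<exists>u. p u \<noteq> q u \<and> anc p l u \<and> anc q l u \<and> anc p u v)"
  using assms
proof (induction rule: converse_rtranclp_induct)
  case (step l m)
  show ?case
  proof (cases "q l = m")
    case True
    then show ?thesis using step by (metis anc_iff)
  next
    case False
    then show ?thesis using step by (metis anc_iff rtranclp.rtrancl_refl)
  qed
qed simp

lemma root_exists:
  assumes "forest n p" "v \<in> {1..n}"
  shows "\<exists>r \<in> roots n p. anc p v r"
  using forest_anc_0[OF assms(1), of v] assms(2)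
proof (induction rule: converse_rtranclp_induct)
  case (step v w)
  show ?case
  proof (cases "w = 0")
    case True
    then show ?thesis using step by (auto simp: roots_def intro!: bexI[of _ v])
  next
    case False
    then have "w \<in> {1..n}" using forest_vertex[OF assms(1), of v] step.hyps(1) by simp
    then show ?thesis using step by (metis anc_iff)
  qed
qed simp

lemma root_unique:
  assumes "forest n p" "r \<in> roots n p" "s \<in> roots n p" "anc p v r" "anc p v s"
  shows "r = s"
proof -
  have "anc p r s \<or> anc p s r" using assms(4,5) by (rule anc_linear)
  moreover have "p r = 0" "p s = 0" "r \<noteq> 0" "s \<noteq> 0" using assms(2,3) by (auto simp: roots_def)
  ultimately show ?thesis using anc_from_0[OF assms(1)] by (metis anc_iff)
qed

lemma finite_forests: "finite {p. forest n p}"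
  by (rule finite_subset[OF _ finite_set_of_finite_funs[of "{1..n}" "{..n}" 0]]) (auto simp: forest_def)

lemma finite_kids: "forest n p \<Longrightarrow> v \<noteq> 0 \<Longrightarrow> finite (kids p v)"
  by (rule finite_subset[of _ "{1..n}"]) (auto dest: forest_vertex[of n p])

lemma finite_roots: "finite (roots n p)"
  by (simp add: roots_def)

lemma improper_children_parent_nonzero: "v \<in> improper_children p \<Longrightarrow> p v \<noteq> 0"
  by (auto simp: improper_children_def)

lemma finite_improper_children: "forest n p \<Longrightarrow> finite (improper_children p)"
  by (rule finite_subset[of _ "{1..n}"]) (auto dest!: improper_children_parent_nonzero dest: forest_vertex[of n p])

text \<open>Only the phantom \<open>0\<close> is lower than \<open>1\<close>, and it is not a
  descendant of any vertex. Edges leading down from vertex 1 are therefore always proper.\<close>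

lemma improper_children_parent_1:
  assumes "forest n p" "p v = 1"
  shows "v \<notin> improper_children p"
proof
  assume "v \<in> improper_children p"
  then have "anc p 0 v" using assms(2) by (auto simp: improper_children_def)
  then have "v = 0" by (rule anc_from_0[OF assms(1)])
  then show False using assms(2) forest_0[OF assms(1)] by simp
qed

text \<open>Vertex 1 itself is the witness: it is lower than \<open>p v\<close>, which cannot be
  \<open>1\<close> without closing a cycle.\<close>

lemma improper_children_ancestor_of_1:
  assumes "forest n p" "anc p 1 v" "p v \<noteq> 0"
  shows "v \<in> improper_children p"
proof -
  have "v \<noteq> 0" using assms(3) forest_0[OF assms(1)] by metis
  then have "p v \<noteq> 1" using forest_acyclic[OF assms(1), of v] assms(2) by metis
  then have "1 < p v" using assms(3) by linarith
  then show ?thesis using assms(2) by (auto simp: improper_children_def)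
qed

subsection \<open>Exchanging a vertex with its parent\<close>

text \<open>No labels are exchanged: only the edge between \<open>a\<close> and its parent is
  reversed and the edge above that parent is moved to \<open>a\<close>. All other vertices keep
  their parents, and the same operation at the old parent undoes the change.\<close>

definition swap_parent :: "nat \<Rightarrow> (nat \<Rightarrow> nat) \<Rightarrow> nat \<Rightarrow> nat" where
  "swap_parent a p = p(a := p (p a), p a := a)"

text \<open>That \<open>q\<close> is again a forest holds because the way up from \<open>p b\<close>
  meets neither \<open>a\<close> nor \<open>b\<close>, as this would close a cycle. It survives the
  exchange, and \<open>a\<close> and \<open>b\<close> still lead to it.\<close>

lemma swap_parent_props:
  assumes p: "forest n p" and a: "p a \<noteq> 0"
  defines "b \<equiv> p a" and "q \<equiv> swap_parent a p"
  shows "a \<noteq> 0" "b \<noteq> a" "p b \<noteq> a" "p b \<noteq> b" "q a = p b" "q b = a" "\<And>v. v \<noteq> a \<Longrightarrow> v \<noteq> b \<Longrightarrow> q v = p v"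
    "swap_parent b q = p" "forest n q"
proof -
  show a0: "a \<noteq> 0" using a forest_0[OF p] by metis
  have b0: "b \<noteq> 0" using a b_def by simp
  show ab: "b \<noteq> a" using forest_acyclic[OF p, of a] a0 b_def by auto
  show pba: "p b \<noteq> a" using forest_acyclic[OF p, of b] b0 b_def anc_parent[of p a] by auto
  show pbb: "p b \<noteq> b" using forest_acyclic[OF p, of b] b0 by auto
  show q: "q a = p b" "q b = a" "\<And>v. v \<noteq> a \<Longrightarrow> v \<noteq> b \<Longrightarrow> q v = p v"
    using ab by (auto simp: q_def swap_parent_def b_def)
  show "swap_parent b q = p"
    using q ab pba pbb by (auto simp: swap_parent_def fun_eq_iff b_def)
  have diff: "u = a \<or> u = b" if "p u \<noteq> q u" for u using q(3) that by metis
  have "anc q (p b) 0"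
  proof (rule ccontr)
    assume "\<not> anc q (p b) 0"
    then obtain u where "u = a \<or> u = b" "anc p (p b) u"
      using anc_transfer[OF forest_anc_0[OF p, of "p b"], of q] diff by blast
    then have "anc p (p b) b" using anc_parent[of p a] b_def by (metis rtranclp_trans)
    then show False using forest_acyclic[OF p] b0 by simp
  qed
  then have "anc q a 0" using q(1) by (metis anc_iff)
  moreover then have "anc q b 0" using q(2) by (metis anc_iff)
  ultimately have "anc q v 0" for v
    using anc_transfer[OF forest_anc_0[OF p, of v], of q] diff by (metis rtranclp_trans)
  moreover have "a \<in> {1..n}" "b \<in> {1..n}" using forest_vertex[OF p a] b_def by auto
  ultimately show "forest n q"
    using p q(1,2) q(3) unfolding forest_def by (metis atLeastAtMost_iff)
qed

text \<open>If the way from \<open>v\<close> to \<open>w\<close> is disturbed, it passes through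
  \<open>a\<close> or \<open>b\<close>, and then \<open>w\<close> lies at or above
  \<open>p b\<close>. Both vertices still reach \<open>p b\<close>, and above it nothing has
  changed.\<close>

lemma swap_parent_anc_imp:
  assumes p: "forest n p" and a: "p a \<noteq> 0" and w: "w \<noteq> a" "w \<noteq> p a" and anc: "anc p v w"
  shows "anc (swap_parent a p) v w"
proof (rule ccontr)
  define b q where "b = p a" and "q = swap_parent a p"
  note props = swap_parent_props[OF p a, folded b_def q_def]
  have diff: "u = a \<or> u = b" if "p u \<noteq> q u" for u using props(7) that by metis
  have up: "anc q a (p b)" "anc q b (p b)"
    using props(5,6) by (metis anc_iff rtranclp.rtrancl_refl)+
  assume not: "\<not> anc (swap_parent a p) v w"
  then obtain u where u: "u = a \<or> u = b" "anc q v u" "anc p u w"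
    using anc_transfer[OF anc, of q] diff q_def by blast
  then have pb: "anc p (p b) w" using w b_def by (metis anc_iff)
  have "\<not> anc q (p b) w" using not u up q_def by (metis rtranclp_trans)
  then obtain u' where "u' = a \<or> u' = b" "anc p (p b) u'"
    using anc_transfer[OF pb, of q] diff by blast
  then have "anc p (p b) b" using anc_parent[of p a] b_def by (metis rtranclp_trans)
  then show False using forest_acyclic[OF p] a b_def by auto
qed

lemma swap_parent_anc:
  assumes p: "forest n p" and a: "p a \<noteq> 0" and w: "w \<noteq> a" "w \<noteq> p a"
  shows "anc (swap_parent a p) v w \<longleftrightarrow> anc p v w"
proof
  note props = swap_parent_props[OF p a]
  assume "anc (swap_parent a p) v w"
  then have "anc (swap_parent (p a) (swap_parent a p)) v w"
    using swap_parent_anc_imp[OF props(9), of "p a" w v] props(1,6) w by simp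
  then show "anc p v w" by (simp only: props(8))
qed (rule swap_parent_anc_imp[OF p a w])

lemma card_roots_swap_parent:
  assumes p: "forest n p" and a: "p a \<noteq> 0"
  shows "card (roots n (swap_parent a p)) = card (roots n p)"
proof -
  define b q where "b = p a" and "q = swap_parent a p"
  note props = swap_parent_props[OF p a, folded b_def q_def]
  have ab: "a \<in> {1..n}" "b \<in> {1..n}" using forest_vertex[OF p a] b_def by auto
  have q: "q v = 0 \<longleftrightarrow> (if v = a then p b = 0 else if v = b then False else p v = 0)" for v
    using props(1,5,6,7) by auto
  show ?thesis
  proof (cases "p b = 0")
    case True
    then have "roots n q = insert a (roots n p - {b})" "b \<in> roots n p" "a \<notin> roots n p"
      using ab a q props(2) by (auto simp: roots_def b_def split: if_splits)
    then show ?thesis unfolding q_def[symmetric] using finite_roots[of n p] props(2)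
      by (metis (no_types, lifting) Diff_iff card_Suc_Diff1 card_insert_disjoint finite_Diff)
  next
    case False
    then have "roots n q = roots n p"
      using ab a q props(2) by (auto simp: roots_def b_def split: if_splits)
    then show ?thesis by (simp add: q_def)
  qed
qed

lemma kids_swap_parent_1:
  assumes p: "forest n p" and a: "p 1 \<noteq> 0"
  shows "kids (swap_parent 1 p) 1 = insert (p 1) (kids p 1)" "p 1 \<notin> kids p 1"
proof -
  note props = swap_parent_props[OF p a]
  show "kids (swap_parent 1 p) 1 = insert (p 1) (kids p 1)"
    using props(2,3,5,6,7) by (auto split: if_splits) (metis)+
  show "p 1 \<notin> kids p 1" using props(3) by simp
qed

text \<open>Only the edges above \<open>1\<close> and above its old parent \<open>b\<close> matter.
  Before, both are improper as far as they exist, since vertex 1 lies below them; afterwards the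
  edge above \<open>b\<close> leads to \<open>1\<close> and is proper, while \<open>1\<close> has
  inherited the edge above \<open>b\<close>, if there was one.\<close>

lemma card_improper_children_swap_parent_1:
  assumes p: "forest n p" and a: "p 1 \<noteq> 0"
  shows "card (improper_children p) = Suc (card (improper_children (swap_parent 1 p)))"
proof -
  define b q where "b = p 1" and "q = swap_parent 1 p"
  note props = swap_parent_props[OF p a, folded b_def q_def]
  define X where "X = improper_children p - {1, b}"
  have "v \<in> improper_children p \<longleftrightarrow> v \<in> improper_children q" if "v \<noteq> 1" "v \<noteq> b" for v
    using swap_parent_anc[OF p a, of v] that props(7) by (simp add: improper_children_def b_def q_def)
  then have Xq: "X = improper_children q - {1, b}" by (auto simp: X_def)
  have "1 \<in> improper_children p" using improper_children_ancestor_of_1[OF p] a by blast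
  moreover have "b \<in> improper_children p \<longleftrightarrow> p b \<noteq> 0"
    using improper_children_ancestor_of_1[OF p, of b] improper_children_parent_nonzero anc_parent[of p 1] b_def by auto
  ultimately have Ip: "improper_children p = insert 1 (if p b \<noteq> 0 then insert b X else X)"
    by (auto simp: X_def)
  have "1 \<in> improper_children q \<longleftrightarrow> p b \<noteq> 0"
    using improper_children_ancestor_of_1[OF props(9), of 1] improper_children_parent_nonzero[of 1 q] props(5) by auto
  moreover have "b \<notin> improper_children q" using improper_children_parent_1[OF props(9) props(6)] .
  ultimately have Iq: "improper_children q = (if p b \<noteq> 0 then insert 1 X else X)"
    by (auto simp: Xq)
  have "finite X" "1 \<notin> X" "b \<notin> X" using finite_improper_children[OF p] by (auto simp: X_def)
  then show ?thesis using Ip Iq props(2) unfolding q_def[symmetric] by auto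
qed

text \<open>The old parent of vertex 1 is remembered as a marked child, and exchanging
  \<open>1\<close> with the marked child is the inverse map. The \<open>Suc k\<close> possible marks
  give the factor.\<close>

lemma sum_trees_nonroot_1:
  fixes W :: "nat \<Rightarrow> 'a::comm_semiring_1"
  shows "(\<Sum>p | parent_tree n p \<and> card (kids p 1) = k \<and> p 1 \<noteq> 0. W (card (improper_children p))) =
    of_nat (Suc k) * (\<Sum>q | parent_tree n q \<and> card (kids q 1) = Suc k. W (Suc (card (improper_children q))))"
    (is "sum _ ?P = _ * sum _ ?Q")
proof -
  have fin: "finite ?Q" by (rule finite_subset[OF _ finite_forests[of n]]) (auto simp: parent_tree_def)
  have "(\<Sum>p\<in>?P. W (card (improper_children p))) = (\<Sum>(q, c) \<in> Sigma ?Q (\<lambda>q. kids q 1). W (Suc (card (improper_children q))))"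
  proof (rule sum.reindex_bij_witness[of _ "\<lambda>(q, c). swap_parent c q" "\<lambda>p. (swap_parent 1 p, p 1)"])
    fix p assume "p \<in> ?P"
    then have p: "forest n p" "card (roots n p) = 1" "card (kids p 1) = k" "p 1 \<noteq> 0"
      by (auto simp: parent_tree_def)
    note props = swap_parent_props[OF p(1,4)]
    show "(case (swap_parent 1 p, p 1) of (q, c) \<Rightarrow> swap_parent c q) = p"
      using props(8) by simp
    show "(case (swap_parent 1 p, p 1) of (q, c) \<Rightarrow> W (Suc (card (improper_children q)))) = W (card (improper_children p))"
      using card_improper_children_swap_parent_1[OF p(1,4)] by simp
    show "(swap_parent 1 p, p 1) \<in> Sigma ?Q (\<lambda>q. kids q 1)"
      using props(6,9) p(2,3) card_roots_swap_parent[OF p(1,4)] kids_swap_parent_1[OF p(1,4)]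
        finite_kids[OF p(1), of 1]
      by (simp add: parent_tree_def)
  next
    fix x assume "x \<in> Sigma ?Q (\<lambda>q. kids q 1)"
    then obtain q c where x: "x = (q, c)" and q: "forest n q" "card (roots n q) = 1" "card (kids q 1) = Suc k" "q c = 1"
      by (auto simp: parent_tree_def)
    then have qc: "q c \<noteq> 0" by simp
    define p where "p = swap_parent c q"
    note props = swap_parent_props[OF q(1) qc, folded p_def, unfolded q(4)]
    have p1: "p 1 = c" "p 1 \<noteq> 0" using props(1,6) by auto
    show "(swap_parent 1 (case x of (q, c) \<Rightarrow> swap_parent c q), (case x of (q, c) \<Rightarrow> swap_parent c q) 1) = x"
      using x props(8) p1 p_def by simp
    have "kids q 1 = insert (p 1) (kids p 1)" "p 1 \<notin> kids p 1"
      using kids_swap_parent_1[OF props(9) p1(2)] props(8) by auto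
    then have "card (kids p 1) = k"
      using q(3) finite_kids[OF props(9), of 1] by simp
    then show "(case x of (q, c) \<Rightarrow> swap_parent c q) \<in> ?P"
      using x p1 props(9) q(2) card_roots_swap_parent[OF q(1) qc]
      by (simp add: parent_tree_def p_def)
  qed
  also have "\<dots> = (\<Sum>q\<in>?Q. \<Sum>c\<in>kids q 1. W (Suc (card (improper_children q))))"
    using fin by (subst sum.Sigma) (auto simp: parent_tree_def intro: finite_kids)
  also have "\<dots> = (\<Sum>q\<in>?Q. of_nat (Suc k) * W (Suc (card (improper_children q))))"
    by (intro sum.cong) auto
  finally show ?thesis by (simp only: sum_distrib_left)
qed

subsection \<open>Deleting the root\<close>

text \<open>Vertex \<open>1\<close> of the tree becomes the phantom root \<open>0\<close> when all labels are lowered by one.\<close>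

definition plant :: "nat \<Rightarrow> (nat \<Rightarrow> nat) \<Rightarrow> nat \<Rightarrow> nat" where
  "plant n h v = (if v \<in> {2..Suc n} then Suc (h (v - 1)) else 0)"

text \<open>The truncation of the subtraction is intended: a parent \<open>1\<close> turns into
  \<open>0\<close>, and the default value \<open>0\<close> is kept.\<close>

definition unplant :: "(nat \<Rightarrow> nat) \<Rightarrow> nat \<Rightarrow> nat" where
  "unplant f v = f (Suc v) - 1"

lemma plant_simps:
  "plant n h 0 = 0" "plant n h 1 = 0" "plant n h (Suc 0) = 0" "v \<in> {1..n} \<Longrightarrow> plant n h (Suc v) = Suc (h v)"
  by (auto simp: plant_def)

lemma anc_plant_Suc:
  assumes h: "forest n h" and anc: "anc h v w" and v: "v \<le> n"
  shows "anc (plant n h) (Suc v) (Suc w)"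
  using anc v
proof (induction rule: converse_rtranclp_induct)
  case (step v v')
  show ?case
  proof (cases "v = 0")
    case True
    then show ?thesis using step forest_0[OF h] by simp
  next
    case False
    then have "plant n h (Suc v) = Suc v'" using step.hyps(1) step.prems by (simp add: plant_simps)
    moreover have "v' \<le> n" using h step.hyps(1) by (auto simp: forest_def)
    ultimately show ?thesis using step.IH anc_iff[of "plant n h" "Suc v"] by simp
  qed
qed simp

lemma anc_plant_0: "anc (plant n h) 0 w \<Longrightarrow> w = 0"
  by (induction rule: rtranclp_induct) (simp_all add: plant_simps)

lemma anc_plantD:
  assumes h: "forest n h" and anc: "anc (plant n h) (Suc v) (Suc w)"
  shows "anc h v w"
proof -
  have "\<forall>v w. x = Suc v \<longrightarrow> y = Suc w \<longrightarrow> anc h v w" if "anc (plant n h) x y" for x y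
    using that
  proof (induction rule: converse_rtranclp_induct)
    case (step x x')
    show ?case
    proof (intro allI impI)
      fix v w assume vw: "x = Suc v" "y = Suc w"
      show "anc h v w"
      proof (cases "v \<in> {1..n}")
        case True
        then have "x' = Suc (h v)" using step.hyps(1) vw by (simp add: plant_simps)
        then show ?thesis using step.IH vw anc_iff[of h v w] by simp
      next
        case False
        then have "x' = 0" using step.hyps(1) vw by (auto simp: plant_def)
        then show ?thesis using step.hyps(2) vw anc_plant_0 by blast
      qed
    qed
  qed simp
  then show ?thesis using anc by blast
qed

lemma forest_plant:
  assumes h: "forest n h"
  shows "forest (Suc n) (plant n h)"
proof -
  have "anc (plant n h) v 0" for v
  proof (cases "v \<in> {1..Suc n}")
    case True
    then have "anc (plant n h) (Suc (v - 1)) (Suc 0)"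
      by (intro anc_plant_Suc[OF h] forest_anc_0[OF h]) auto
    then have "anc (plant n h) v 1" using True by simp
    moreover have "anc (plant n h) 1 0" using anc_parent[of "plant n h" 1] by (simp add: plant_simps)
    ultimately show ?thesis by (rule rtranclp_trans)
  next
    case False
    then have "plant n h v = 0" by (auto simp: plant_def)
    then show ?thesis using anc_parent by metis
  qed
  moreover have "h v \<le> n" for v using h by (simp add: forest_def)
  ultimately show ?thesis
    by (auto simp: forest_def plant_def)
qed

lemma roots_plant: "roots (Suc n) (plant n h) = {1}"
  by (auto simp: roots_def plant_def)

lemma unplant_plant: "forest n h \<Longrightarrow> unplant (plant n h) = h"
  by (auto simp: unplant_def plant_def fun_eq_iff forest_outside)

lemma kids_plant_1: "kids (plant n h) 1 = Suc ` roots n h"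
proof (intro equalityI subsetI)
  fix v assume "v \<in> kids (plant n h) 1"
  then have "v = Suc (v - 1)" "v - 1 \<in> roots n h"
    by (auto simp: plant_def roots_def split: if_splits)
  then show "v \<in> Suc ` roots n h" by (rule image_eqI)
qed (auto simp: plant_def roots_def)

text \<open>The shift of labels preserves all comparisons, and the edges at the new root
  \<open>1\<close>, the only ones without a counterpart in \<open>h\<close>, are never
  improper.\<close>

lemma improper_children_plant:
  assumes h: "forest n h"
  shows "improper_children (plant n h) = Suc ` improper_children h"
proof (intro equalityI subsetI)
  fix v assume "v \<in> improper_children (plant n h)"
  then obtain l where l: "anc (plant n h) l v" "l < plant n h v" by (auto simp: improper_children_def)
  then have "v \<in> {2..Suc n}" by (auto simp: plant_def split: if_splits)
  then obtain u where u: "v = Suc u" "u \<in> {1..n}" by (cases v) auto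
  have "l \<noteq> 0"
  proof
    assume "l = 0"
    then have "v = 0" using l(1) anc_plant_0[of n h v] by simp
    then show False using u(1) by simp
  qed
  then obtain m where m: "l = Suc m" by (cases l) auto
  have "anc h m u" using anc_plantD[OF h, of m u] l(1) u(1) m by simp
  moreover have "m < h u" using l(2) u m by (simp add: plant_simps)
  ultimately show "v \<in> Suc ` improper_children h" using u(1) by (auto simp: improper_children_def)
next
  fix v assume "v \<in> Suc ` improper_children h"
  then obtain u l where u: "v = Suc u" "anc h l u" "l < h u" by (auto simp: improper_children_def)
  then have "u \<in> {1..n}" "h u \<in> {1..n}" using forest_vertex[OF h, of u] by auto
  then have "anc (plant n h) (Suc l) v" "Suc l < plant n h v"
    using u anc_plant_Suc[OF h u(2)] by (auto simp: plant_simps)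
  then show "v \<in> improper_children (plant n h)" by (auto simp: improper_children_def)
qed

lemma tree_root_1:
  assumes f: "parent_tree (Suc n) f" "f 1 = 0"
  shows "forest n (unplant f)" "plant n (unplant f) = f"
proof -
  have forest: "forest (Suc n) f" using f(1) by (simp add: parent_tree_def)
  have "1 \<in> roots (Suc n) f" using f(2) by (simp add: roots_def)
  moreover obtain r where "roots (Suc n) f = {r}"
    using f(1) by (auto simp: parent_tree_def card_1_singleton_iff)
  ultimately have root: "roots (Suc n) f = {1}" by simp
  \<comment> \<open>As \<open>1\<close> is the only root, the parent of any other vertex is positive
    and lowering it by one loses nothing.\<close>
  have nz: "f v \<noteq> 0" if "v \<in> {2..Suc n}" for v
  proof
    assume "f v = 0"
    then have "v \<in> roots (Suc n) f" using that by (simp add: roots_def)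
    then show False using root that by simp
  qed
  have "plant n (unplant f) v = f v" for v
  proof (cases "v \<in> {2..Suc n}")
    case True
    then show ?thesis using nz[OF True] by (simp add: plant_def unplant_def)
  next
    case False
    then have "v = 1 \<or> v \<notin> {1..Suc n}" by auto
    then have "f v = 0" using f(2) forest_outside[OF forest, of v] by metis
    then show ?thesis using False by (simp add: plant_def)
  qed
  then show "plant n (unplant f) = f" by blast
  define h where "h = unplant f"
  have h: "h v = 0" if "v \<notin> {1..n}" for v
    using that f(2) forest_outside[OF forest, of "Suc v"] by (cases v) (auto simp: h_def unplant_def)
  have "anc h v 0" for v
  proof -
    have "\<forall>v. x = Suc v \<longrightarrow> anc h v 0" if "anc f x y" "y = 0" for x y
      using that
    proof (induction rule: converse_rtranclp_induct)
      case (step x x')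
      show ?case
      proof (intro allI impI)
        fix v assume v: "x = Suc v"
        show "anc h v 0"
        proof (cases "v \<in> {1..n}")
          case True
          then have "x' = Suc (h v)"
            using step.hyps(1) v nz[of "Suc v"] by (auto simp: h_def unplant_def)
          then show ?thesis using step.IH step.prems anc_iff[of h v 0] by simp
        next
          case False
          then show ?thesis using h anc_parent by metis
        qed
      qed
    qed simp
    then show ?thesis using forest_anc_0[OF forest, of "Suc v"] by blast
  qed
  moreover have "h v \<le> n" for v
  proof -
    have "f (Suc v) \<le> Suc n" using forest by (simp add: forest_def)
    then show ?thesis by (simp add: h_def unplant_def)
  qed
  ultimately show "forest n (unplant f)"
    using h by (simp add: forest_def h_def[symmetric])
qed

lemma sum_trees_root_1:
  "(\<Sum>p | parent_tree (Suc n) p \<and> card (kids p 1) = k \<and> p 1 = 0. W (card (improper_children p))) =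
   (\<Sum>h | forest n h \<and> card (roots n h) = k. W (card (improper_children h)))"
proof (rule sum.reindex_bij_witness[of _ "plant n" unplant])
  fix p assume p: "p \<in> {p. parent_tree (Suc n) p \<and> card (kids p 1) = k \<and> p 1 = 0}"
  then have h: "forest n (unplant p)" "plant n (unplant p) = p"
    using tree_root_1[of n p] by auto
  then show "plant n (unplant p) = p" by simp
  have "kids p 1 = Suc ` roots n (unplant p)" using kids_plant_1[of n "unplant p"] h(2) by simp
  then show "unplant p \<in> {h. forest n h \<and> card (roots n h) = k}"
    using h(1) p by (simp add: card_image)
  have "improper_children p = Suc ` improper_children (unplant p)" using improper_children_plant[OF h(1)] h(2) by simp
  then show "W (card (improper_children (unplant p))) = W (card (improper_children p))" by (simp add: card_image)
next
  fix h assume "h \<in> {h. forest n h \<and> card (roots n h) = k}"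
  then show "unplant (plant n h) = h"
    "plant n h \<in> {p. parent_tree (Suc n) p \<and> card (kids p 1) = k \<and> p 1 = 0}"
    unfolding kids_plant_1[of n h, simplified]
    by (auto simp: unplant_plant parent_tree_def forest_plant roots_plant kids_plant_1[simplified] card_image plant_simps)
qed

subsection \<open>Moving children of vertex 1 to the root\<close>

definition detach :: "nat set \<Rightarrow> (nat \<Rightarrow> nat) \<Rightarrow> nat \<Rightarrow> nat" where
  "detach S g v = (if v \<in> S then 0 else g v)"

definition attach :: "nat set \<Rightarrow> (nat \<Rightarrow> nat) \<Rightarrow> nat \<Rightarrow> nat" where
  "attach S h v = (if v \<in> S then 1 else h v)"

text \<open>The roots of the trees that do not contain vertex 1. They are the roots to be hung below
  \<open>1\<close>, and they tell which children had been cut off.\<close>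

definition far_roots :: "nat \<Rightarrow> (nat \<Rightarrow> nat) \<Rightarrow> nat set" where
  "far_roots n h = {v \<in> roots n h. \<not> anc h 1 v}"

lemma detach_diff: "detach S g v \<noteq> g v \<Longrightarrow> v \<in> S"
  by (simp add: detach_def split: if_splits)

lemma forest_detach:
  assumes g: "forest n g"
  shows "forest n (detach S g)"
proof -
  have "anc (detach S g) v 0" for v
  proof (rule ccontr)
    assume not: "\<not> anc (detach S g) v 0"
    then obtain u where "g u \<noteq> detach S g u" "anc (detach S g) v u"
      using anc_transfer[OF forest_anc_0[OF g, of v], of "detach S g"] by blast
    moreover then have "detach S g u = 0" by (auto simp: detach_def)
    ultimately show False
      using not anc_parent[of "detach S g" u] by (metis rtranclp_trans)
  qed
  moreover have "g v \<le> n" for v using g by (simp add: forest_def)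
  ultimately show ?thesis using forest_outside[OF g] by (simp add: forest_def detach_def)
qed

text \<open>A child of \<open>1\<close> that is also an ancestor of \<open>1\<close> would close a
  cycle. Hence cutting off children of \<open>1\<close> leaves the way from \<open>1\<close> to its
  root intact.\<close>

lemma detach_not_above_1:
  assumes g: "forest n g" and S: "S \<subseteq> kids g 1" and u: "u \<in> S"
  shows "\<not> anc g 1 u" "\<not> anc (detach S g) 1 u"
proof -
  have not: "\<not> anc g 1 u" if "u \<in> S" for u
  proof
    assume "anc g 1 u"
    then have "anc g (g u) u" using S that by auto
    then have "u = 0" by (rule forest_acyclic[OF g])
    then show False using S that forest_0[OF g] by auto
  qed
  show "\<not> anc g 1 u" by (rule not[OF u])
  show "\<not> anc (detach S g) 1 u"
  proof
    assume "anc (detach S g) 1 u"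
    then have "anc g 1 u \<or> (\<exists>v. detach S g v \<noteq> g v \<and> anc (detach S g) 1 v \<and> anc g 1 v \<and> anc (detach S g) v u)"
      by (rule anc_transfer[of "detach S g" 1 u g])
    then show False using not u detach_diff[of S g] by blast
  qed
qed

lemma anc_1_detach:
  assumes g: "forest n g" and S: "S \<subseteq> kids g 1"
  shows "anc (detach S g) 1 v \<longleftrightarrow> anc g 1 v"
proof
  assume "anc (detach S g) 1 v"
  then show "anc g 1 v"
    using anc_transfer[of "detach S g" 1 v g] detach_not_above_1[OF g S]
    by (metis detach_def)
next
  assume "anc g 1 v"
  then show "anc (detach S g) 1 v"
    using anc_transfer[of g 1 v "detach S g"] detach_not_above_1[OF g S]
    by (metis detach_def)
qed

lemma roots_detach:
  assumes g: "forest n g" and S: "S \<subseteq> kids g 1"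
  shows "roots n (detach S g) = S \<union> roots n g" "S \<inter> roots n g = {}"
proof -
  have "v \<in> {1..n}" if "v \<in> S" for v using forest_vertex[OF g, of v] S that by auto
  then show "roots n (detach S g) = S \<union> roots n g" by (auto simp: roots_def detach_def)
  show "S \<inter> roots n g = {}" using S by (auto simp: roots_def)
qed

text \<open>The single root of the tree is an ancestor of \<open>1\<close> and remains one, so
  precisely the cut vertices are far; this recovers \<open>S\<close> from the forest.\<close>

lemma far_roots_detach:
  assumes g: "parent_tree n g" and S: "S \<subseteq> kids g 1" and n: "1 \<le> n"
  shows "far_roots n (detach S g) = S"
proof -
  have f: "forest n g" using g by (simp add: parent_tree_def)
  obtain r where r: "roots n g = {r}" using g by (auto simp: parent_tree_def card_1_singleton_iff)
  then have "anc g 1 r" using root_exists[OF f, of 1] n by auto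
  then show ?thesis
    using r roots_detach[OF f S] detach_not_above_1[OF f S] anc_1_detach[OF f S]
    by (auto simp: far_roots_def)
qed

text \<open>The edges that are cut lead down from \<open>1\<close> and were proper. Cutting takes
  descendants only from \<open>1\<close> and its ancestors: the edges above these stay improper
  because of vertex 1, and every other remaining edge has the same descendants as before.\<close>

lemma improper_children_detach:
  assumes g: "forest n g" and S: "S \<subseteq> kids g 1"
  shows "improper_children (detach S g) = improper_children g"
proof -
  let ?h = "detach S g"
  have h: "forest n ?h" by (rule forest_detach[OF g])
  have "w \<in> improper_children ?h \<longleftrightarrow> w \<in> improper_children g" for w
  proof (cases "w \<in> S")
    case True
    then have "g w = 1" "?h w = 0" using S by (auto simp: detach_def)
    then show ?thesis using improper_children_parent_1[OF g] improper_children_parent_nonzero by blast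
  next
    case False
    then have eq: "?h w = g w" by (simp add: detach_def)
    show ?thesis
    proof (cases "g w = 0 \<or> anc g 1 w")
      case True
      then show ?thesis
        using improper_children_ancestor_of_1[OF g, of w] improper_children_ancestor_of_1[OF h, of w] improper_children_parent_nonzero
          anc_1_detach[OF g S] eq by metis
    next
      case w: False
      have "anc ?h l w \<longleftrightarrow> anc g l w" for l
      proof
        assume "anc ?h l w"
        then show "anc g l w"
        proof (rule contrapos_pp)
          assume "\<not> anc g l w"
          show "\<not> anc ?h l w"
          proof
            assume "anc ?h l w"
            with \<open>\<not> anc g l w\<close> obtain u where "?h u \<noteq> g u" "anc ?h u w"
              using anc_transfer[of ?h l w g] by blast
            then have "u \<in> S" "?h u = 0" by (auto simp: detach_def split: if_splits)
            then have "anc ?h 0 w" using \<open>anc ?h u w\<close> False anc_iff[of ?h u w] by auto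
            then show False using anc_from_0[OF h] w forest_0[OF g] by blast
          qed
        qed
      next
        assume anc: "anc g l w"
        show "anc ?h l w"
        proof (rule ccontr)
          assume "\<not> anc ?h l w"
          then obtain u where "?h u \<noteq> g u" "anc g u w"
            using anc_transfer[OF anc, of ?h] by metis
          then have "u \<in> S" "g u = 1" using S by (auto simp: detach_def split: if_splits)
          then show False using \<open>anc g u w\<close> False w anc_iff[of g u w] by auto
        qed
      qed
      then show ?thesis by (simp add: improper_children_def eq)
    qed
  qed
  then show ?thesis by blast
qed

text \<open>The way from \<open>1\<close> to \<open>0\<close> contains no far root and therefore
  survives, and every far root now continues through \<open>1\<close>. Exactly one root, that of the
  tree containing \<open>1\<close>, is not far.\<close>

lemma attach_far_roots:
  assumes h: "forest n h" and n: "1 \<le> n"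
  defines "g \<equiv> attach (far_roots n h) h"
  shows "parent_tree n g" "far_roots n h \<subseteq> kids g 1" "detach (far_roots n h) g = h"
    "card (roots n h) = Suc (card (far_roots n h))"
proof -
  let ?S = "far_roots n h"
  have S0: "h v = 0" "v \<in> {1..n}" if "v \<in> ?S" for v using that by (auto simp: far_roots_def roots_def)
  show "?S \<subseteq> kids g 1" by (auto simp: g_def attach_def)
  show "detach ?S g = h" using S0 by (auto simp: g_def attach_def detach_def fun_eq_iff)
  have diff: "u \<in> ?S" if "h u \<noteq> g u" for u using that by (auto simp: g_def attach_def split: if_splits)
  have "anc g 1 0"
  proof (rule ccontr)
    assume "\<not> anc g 1 0"
    then obtain u where "u \<in> ?S" "anc h 1 u"
      using anc_transfer[OF forest_anc_0[OF h, of 1], of g] diff by blast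
    then show False by (simp add: far_roots_def)
  qed
  then have "anc g u 0" if "u \<in> ?S" for u
    using anc_iff[of g u 0] that by (simp add: g_def attach_def)
  then have "anc g v 0" for v
    using anc_transfer[OF forest_anc_0[OF h, of v], of g] diff by (meson rtranclp_trans)
  moreover have "h v \<le> n" for v using h by (simp add: forest_def)
  ultimately have forest: "forest n g"
    using forest_outside[OF h] S0(2) n by (auto simp: forest_def g_def attach_def)
  obtain r where r: "r \<in> roots n h" "anc h 1 r" using root_exists[OF h, of 1] n by auto
  have "s = r" if "s \<in> roots n h - ?S" for s
    using root_unique[OF h _ r(1) _ r(2), of s] that by (simp add: far_roots_def)
  moreover have "r \<in> roots n h - ?S" using r by (simp add: far_roots_def)
  ultimately have "roots n h - ?S = {r}" by blast
  moreover have "roots n g = roots n h - ?S"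
    unfolding roots_def g_def attach_def by (auto split: if_splits)
  ultimately show "parent_tree n g" using forest by (simp add: parent_tree_def)
  have "roots n h = insert r ?S" "r \<notin> ?S" using \<open>roots n h - ?S = {r}\<close> r by (auto simp: far_roots_def)
  moreover have "finite ?S" using finite_roots by (simp add: far_roots_def)
  ultimately show "card (roots n h) = Suc (card ?S)" by simp
qed

lemma sum_forests:
  fixes W :: "nat \<Rightarrow> 'a::comm_semiring_1"
  assumes n: "1 \<le> n"
  shows "(\<Sum>h | forest n h \<and> card (roots n h) = Suc k. W (card (improper_children h))) =
    (\<Sum>g | parent_tree n g. of_nat (card (kids g 1) choose k) * W (card (improper_children g)))"
    (is "sum _ ?H = sum _ ?G")
proof -
  have fin: "finite ?G" by (rule finite_subset[OF _ finite_forests[of n]]) (auto simp: parent_tree_def)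
  have fin_kids: "finite (kids g 1)" if "g \<in> ?G" for g
    using that by (auto simp: parent_tree_def intro: finite_kids)
  let ?S = "\<lambda>g. {S. S \<subseteq> kids g 1 \<and> card S = k}"
  have "(\<Sum>h\<in>?H. W (card (improper_children h))) = (\<Sum>(g, S) \<in> Sigma ?G ?S. W (card (improper_children g)))"
  proof (rule sum.reindex_bij_witness[of _ "\<lambda>(g, S). detach S g"
        "\<lambda>h. (attach (far_roots n h) h, far_roots n h)"])
    fix h assume h: "h \<in> ?H"
    then have "forest n h" by simp
    note props = attach_far_roots[OF this n]
    show "(case (attach (far_roots n h) h, far_roots n h) of (g, S) \<Rightarrow> detach S g) = h"
      using props(3) by simp
    show "(attach (far_roots n h) h, far_roots n h) \<in> Sigma ?G ?S"
      using props h by simp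
    show "(case (attach (far_roots n h) h, far_roots n h) of (g, S) \<Rightarrow> W (card (improper_children g))) = W (card (improper_children h))"
      using improper_children_detach[of n, OF _ props(2)] props(1,3) by (simp add: parent_tree_def)
  next
    fix x assume "x \<in> Sigma ?G ?S"
    then obtain g S where x: "x = (g, S)" and g: "parent_tree n g" and S: "S \<subseteq> kids g 1" "card S = k"
      by auto
    have f: "forest n g" "card (roots n g) = 1" using g by (auto simp: parent_tree_def)
    have fr: "far_roots n (detach S g) = S" by (rule far_roots_detach[OF g S(1) n])
    moreover have "attach S (detach S g) = g" using S(1) by (auto simp: attach_def detach_def fun_eq_iff)
    ultimately show "(attach (far_roots n (case x of (g, S) \<Rightarrow> detach S g)) (case x of (g, S) \<Rightarrow> detach S g),
        far_roots n (case x of (g, S) \<Rightarrow> detach S g)) = x"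
      by (simp add: x)
    have "card (roots n (detach S g)) = Suc k"
      using attach_far_roots(4)[OF forest_detach[OF f(1)] n, of S] S(2) fr by simp
    then show "(case x of (g, S) \<Rightarrow> detach S g) \<in> ?H"
      using forest_detach[OF f(1)] by (simp add: x)
  qed
  also have "\<dots> = (\<Sum>g\<in>?G. \<Sum>S\<in>?S g. W (card (improper_children g)))"
    using fin fin_kids by (subst sum.Sigma) auto
  also have "\<dots> = (\<Sum>g\<in>?G. of_nat (card (kids g 1) choose k) * W (card (improper_children g)))"
    using fin_kids by (intro sum.cong refl) (simp add: n_subsets)
  finally show ?thesis .
qed

subsection \<open>The recurrence\<close>

text \<open>Edges below vertex 1 are proper, so both kinds together are at most all \<open>n\<close>
  edges. This keeps the exponents of \<open>z\<close> in the recurrence from being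
  truncated.\<close>

lemma card_kids_improper_children_le:
  assumes g: "parent_tree (Suc n) g"
  shows "card (kids g 1) + card (improper_children g) \<le> n"
proof -
  have f: "forest (Suc n) g" using g by (simp add: parent_tree_def)
  have "card (kids g 1) + card (improper_children g) = card (kids g 1 \<union> improper_children g)"
    using improper_children_parent_1[OF f] by (intro card_Un_disjoint[symmetric] finite_kids[OF f] finite_improper_children[OF f]) auto
  also have "\<dots> \<le> card ({1..Suc n} - roots (Suc n) g)"
  proof (rule card_mono)
    show "kids g 1 \<union> improper_children g \<subseteq> {1..Suc n} - roots (Suc n) g"
    proof
      fix v assume "v \<in> kids g 1 \<union> improper_children g"
      then have "g v \<noteq> 0" using improper_children_parent_nonzero by auto
      then show "v \<in> {1..Suc n} - roots (Suc n) g" using forest_vertex[OF f] by (auto simp: roots_def)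
    qed
  qed simp
  also have "\<dots> = n"
    using g by (subst card_Diff_subset) (auto simp: parent_tree_def finite_roots roots_def)
  finally show ?thesis .
qed

text \<open>A tree on \<open>n + 1\<close> vertices has \<open>n\<close> edges, so the exponent of
  \<open>z\<close> counts the proper edges other than the \<open>k\<close> edges below vertex
  1.\<close>

definition tree_sum :: "'a::comm_semiring_1 \<Rightarrow> 'a \<Rightarrow> nat \<Rightarrow> nat \<Rightarrow> 'a" where
  "tree_sum y z n k = (\<Sum>p | parent_tree (Suc n) p \<and> card (kids p 1) = k.
     y ^ card (improper_children p) * z ^ (n - k - card (improper_children p)))"

lemma finite_parent_trees: "finite {p. parent_tree n p \<and> P p}"
  by (rule finite_subset[OF _ finite_forests[of n]]) (auto simp: parent_tree_def)

lemma tree_sum_split: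
  "tree_sum y z n k = of_nat (Suc k) * y * tree_sum y z n (Suc k) +
    (\<Sum>h | forest n h \<and> card (roots n h) = k. y ^ card (improper_children h) * z ^ (n - k - card (improper_children h)))"
proof -
  let ?W = "\<lambda>i. y ^ i * z ^ (n - k - i)"
  have "{p. parent_tree (Suc n) p \<and> card (kids p 1) = k} =
      {p. parent_tree (Suc n) p \<and> card (kids p 1) = k \<and> p 1 \<noteq> 0} \<union>
      {p. parent_tree (Suc n) p \<and> card (kids p 1) = k \<and> p 1 = 0}" by auto
  then have "tree_sum y z n k =
      (\<Sum>p | parent_tree (Suc n) p \<and> card (kids p 1) = k \<and> p 1 \<noteq> 0. ?W (card (improper_children p))) +
      (\<Sum>p | parent_tree (Suc n) p \<and> card (kids p 1) = k \<and> p 1 = 0. ?W (card (improper_children p)))"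
    unfolding tree_sum_def by (simp only:) (rule sum.union_disjoint; auto simp: finite_parent_trees)
  also have "(\<Sum>p | parent_tree (Suc n) p \<and> card (kids p 1) = k \<and> p 1 \<noteq> 0. ?W (card (improper_children p))) =
      of_nat (Suc k) * (\<Sum>q | parent_tree (Suc n) q \<and> card (kids q 1) = Suc k. ?W (Suc (card (improper_children q))))"
    by (rule sum_trees_nonroot_1)
  \<comment> \<open>With \<open>i\<close> improper edges after the exchange,
    \<open>n - k - Suc i\<close> equals \<open>n - Suc k - i\<close>: the power of \<open>z\<close>
    is unchanged and only a factor \<open>y\<close> appears.\<close>
  also have "\<dots> = of_nat (Suc k) * y * tree_sum y z n (Suc k)"
    by (simp add: tree_sum_def sum_distrib_left mult.assoc)
  also have "(\<Sum>p | parent_tree (Suc n) p \<and> card (kids p 1) = k \<and> p 1 = 0. ?W (card (improper_children p))) =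
      (\<Sum>h | forest n h \<and> card (roots n h) = k. ?W (card (improper_children h)))"
    by (rule sum_trees_root_1)
  finally show ?thesis .
qed

text \<open>On at least two vertices a tree rooted at \<open>1\<close> gives \<open>1\<close> some
  child, so only trees with another root contribute.\<close>

lemma tree_sum_rec_0: "tree_sum y z (Suc n) 0 = y * tree_sum y z (Suc n) 1"
proof -
  have "card (roots (Suc n) h) \<noteq> 0" if "forest (Suc n) h" for h
  proof -
    have "roots (Suc n) h \<noteq> {}" using root_exists[OF that, of 1] by auto
    then show ?thesis using finite_roots by (simp add: card_eq_0_iff)
  qed
  then have "{h. forest (Suc n) h \<and> card (roots (Suc n) h) = 0} = {}" by blast
  then show ?thesis by (subst tree_sum_split) (simp only:, simp)
qed

text \<open>The trees \<open>g\<close> are sorted by the number \<open>j\<close> of children of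
  vertex 1. The \<open>j - k\<close> edges below it that are not cut carry a factor \<open>z\<close>
  in the forest, but are left out of the weight in \<open>tree_sum\<close> at \<open>j\<close>;
  hence the power \<open>z ^ (j - k)\<close>.\<close>

lemma tree_sum_rec_Suc:
  "tree_sum y z (Suc n) (Suc k) = of_nat (Suc (Suc k)) * y * tree_sum y z (Suc n) (Suc (Suc k)) +
    (\<Sum>j\<le>n. of_nat (j choose k) * z ^ (j - k) * tree_sum y z n j)"
proof -
  let ?G = "{g. parent_tree (Suc n) g}"
  let ?W = "\<lambda>i. y ^ i * z ^ (n - k - i)"
  have "(\<Sum>h | forest (Suc n) h \<and> card (roots (Suc n) h) = Suc k. ?W (card (improper_children h))) =
      (\<Sum>g\<in>?G. of_nat (card (kids g 1) choose k) * ?W (card (improper_children g)))"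
    by (rule sum_forests[where W = ?W]) simp
  also have "\<dots> = (\<Sum>j\<le>n. \<Sum>g | g \<in> ?G \<and> card (kids g 1) = j. of_nat (card (kids g 1) choose k) * ?W (card (improper_children g)))"
  proof (rule sum.group[symmetric])
    show "finite ?G" using finite_parent_trees[of "Suc n" "\<lambda>_. True"] by simp
    show "(\<lambda>g. card (kids g 1)) ` ?G \<subseteq> {..n}"
    proof
      fix j assume "j \<in> (\<lambda>g. card (kids g 1)) ` ?G"
      then obtain g where "parent_tree (Suc n) g" "j = card (kids g 1)" by blast
      then show "j \<in> {..n}" using card_kids_improper_children_le[of n g] by simp
    qed
  qed simp
  also have "\<dots> = (\<Sum>j\<le>n. of_nat (j choose k) * z ^ (j - k) * tree_sum y z n j)"
    unfolding tree_sum_def sum_distrib_left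
  proof (intro sum.cong)
    fix j g assume "g \<in> {p. parent_tree (Suc n) p \<and> card (kids p 1) = j}"
    then have g: "parent_tree (Suc n) g" "card (kids g 1) = j" by auto
    show "of_nat (card (kids g 1) choose k) * ?W (card (improper_children g)) =
        of_nat (j choose k) * z ^ (j - k) * (y ^ card (improper_children g) * z ^ (n - j - card (improper_children g)))"
    proof (cases "k \<le> j")
      case True
      then have "n - k - card (improper_children g) = (j - k) + (n - j - card (improper_children g))"
        using card_kids_improper_children_le[OF g(1)] g(2) by simp
      then have "z ^ (n - k - card (improper_children g)) = z ^ (j - k) * z ^ (n - j - card (improper_children g))"
        by (simp only: power_add)
      then show ?thesis by (simp only: g(2) ac_simps)
    next
      case False
      then show ?thesis unfolding g(2) by (simp add: binomial_eq_0)
    qed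
  qed auto
  finally show ?thesis by (subst tree_sum_split) simp
qed

lemma tree_sum_eq_0: "n < k \<Longrightarrow> tree_sum y z n k = 0"
proof -
  assume "n < k"
  then have "card (kids p 1) \<noteq> k" if "parent_tree (Suc n) p" for p
    using card_kids_improper_children_le[OF that] by linarith
  then have "{p. parent_tree (Suc n) p \<and> card (kids p 1) = k} = {}" by blast
  then show ?thesis unfolding tree_sum_def by (simp only: sum.empty)
qed

lemma tree_sum_0: "tree_sum y z 0 k = (if k = 0 then 1 else 0)"
proof -
  have f0: "p = (\<lambda>_. 0)" if p: "parent_tree (Suc 0) p" for p
  proof -
    have f: "forest 1 p" "card (roots 1 p) = 1" using p by (auto simp: parent_tree_def)
    have "p v = 0" for v
    proof (rule ccontr)
      assume "p v \<noteq> 0"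
      then have v: "v \<in> {1..1}" "p v \<in> {1..1}" using forest_vertex[OF f(1), of v] by blast+
      then have "anc p (p v) v" by simp
      then have "v = 0" by (rule forest_acyclic[OF f(1)])
      then show False using v by simp
    qed
    then show ?thesis by auto
  qed
  have "forest (Suc 0) (\<lambda>_. 0)" using anc_parent[of "\<lambda>_. 0"] by (simp add: forest_def)
  moreover have "roots (Suc 0) (\<lambda>_. 0) = {1}" by (auto simp: roots_def)
  ultimately have "{p. parent_tree (Suc 0) p \<and> card (kids p 1) = 0} = {\<lambda>_. 0}"
    using f0 by (auto simp: parent_tree_def)
  moreover have "improper_children (\<lambda>_. 0) = {}" using improper_children_parent_nonzero by blast
  ultimately have "tree_sum y z 0 0 = 1" by (simp add: tree_sum_def)
  then show ?thesis by (simp add: tree_sum_eq_0)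
qed

section \<open>Parent functions and rooted graphs\<close>

text \<open>The path is kept simple while the walk is followed: on a repeated vertex it is cut back
  to the first visit.\<close>

lemma path_between_if_walk:
  assumes "(\<lambda>x y. {x, y} \<in> Edges T \<and> y \<in> Verts T)\<^sup>*\<^sup>* u v" "u \<in> Verts T"
  shows "\<exists>q. path_between T u q v"
  using assms(1)
proof (induction rule: rtranclp_induct)
  case base
  have "path_between T u [u] u" using assms(2) by (simp add: path_between_def simple_path_def)
  then show ?case by blast
next
  case (step v w)
  then obtain q where q: "simple_path T q" "hd q = u" "last q = v" by (auto simp: path_between_def)
  show ?case
  proof (cases "w \<in> set q")
    case True
    then obtain a b where ab: "q = a @ w # b" by (auto dest: split_list)
    have "path_between T u (a @ [w]) w"
      using q unfolding path_between_def simple_path_def ab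
      by (auto simp: successively_append_iff hd_append)
    then show ?thesis by blast
  next
    case False
    have "path_between T u (q @ [w]) w"
      using q step.hyps False unfolding path_between_def simple_path_def
      by (auto simp: successively_append_iff)
    then show ?thesis by blast
  qed
qed

definition graph_of :: "nat \<Rightarrow> (nat \<Rightarrow> nat) \<Rightarrow> nat rooted_graph" where
  "graph_of n p = \<lparr>Verts = {1..n}, Edges = {{v, p v} |v. p v \<noteq> 0}, Root = the_elem (roots n p)\<rparr>"

lemma graph_of_simps [simp]:
  "Verts (graph_of n p) = {1..n}" "Root (graph_of n p) = the_elem (roots n p)"
  by (simp_all add: graph_of_def)

lemma edge_graph_of:
  "{u, v} \<in> Edges (graph_of n p) \<longleftrightarrow> p u = v \<and> v \<noteq> 0 \<or> p v = u \<and> u \<noteq> 0"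
  by (auto simp: graph_of_def doubleton_eq_iff)

locale rooted_parent_tree =
  fixes n :: nat and p :: "nat \<Rightarrow> nat"
  assumes tree: "parent_tree n p"
begin

abbreviation "T \<equiv> graph_of n p"
abbreviation "r \<equiv> the_elem (roots n p)"

lemma forest: "forest n p"
  using tree by (simp add: parent_tree_def)

lemma in_roots_iff: "v \<in> roots n p \<longleftrightarrow> v = r"
proof -
  obtain s where "roots n p = {s}"
    using tree by (auto simp: parent_tree_def card_1_singleton_iff)
  then show ?thesis by simp
qed

lemma root: "r \<in> {1..n}" "p r = 0"
proof -
  have "r \<in> roots n p" by (simp only: in_roots_iff)
  then show "r \<in> {1..n}" "p r = 0" unfolding roots_def by blast+
qed

lemma anc_root: "v \<in> {1..n} \<Longrightarrow> anc p v r"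
  using root_exists[OF forest] in_roots_iff by metis

lemma anc_walk:
  assumes "anc p v w" "w \<noteq> 0"
  shows "(\<lambda>x y. {x, y} \<in> Edges T \<and> y \<in> {1..n})\<^sup>*\<^sup>* v w" "(\<lambda>x y. {x, y} \<in> Edges T \<and> y \<in> {1..n})\<^sup>*\<^sup>* w v"
proof -
  have "(\<lambda>x y. {x, y} \<in> Edges T \<and> y \<in> {1..n})\<^sup>*\<^sup>* v w \<and> (\<lambda>x y. {x, y} \<in> Edges T \<and> y \<in> {1..n})\<^sup>*\<^sup>* w v"
    using assms
  proof (induction rule: rtranclp_induct)
    case (step x y)
    have "p x \<noteq> 0" using step.hyps(2) step.prems by simp
    then have xy: "x \<in> {1..n}" "y \<in> {1..n}" using forest_vertex[OF forest, of x] step.hyps(2) by auto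
    have e: "{x, y} \<in> Edges T" "{y, x} \<in> Edges T"
      using step.hyps(2) step.prems by (simp_all add: edge_graph_of)
    then show ?case
      using step.IH e xy
      by (auto intro: rtranclp.rtrancl_into_rtrancl converse_rtranclp_into_rtranclp)
  qed simp
  then show "(\<lambda>x y. {x, y} \<in> Edges T \<and> y \<in> {1..n})\<^sup>*\<^sup>* v w" "(\<lambda>x y. {x, y} \<in> Edges T \<and> y \<in> {1..n})\<^sup>*\<^sup>* w v"
    by blast+
qed

lemma connected:
  assumes "u \<in> {1..n}" "v \<in> {1..n}"
  shows "\<exists>q. path_between T u q v"
proof (rule path_between_if_walk)
  have "r \<noteq> 0" using root(1) by auto
  then show "(\<lambda>x y. {x, y} \<in> Edges T \<and> y \<in> Verts T)\<^sup>*\<^sup>* u v"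
    using anc_walk(1)[OF anc_root[OF assms(1)]] anc_walk(2)[OF anc_root[OF assms(2)]]
    by simp
qed (use assms in simp)

text \<open>The count includes \<open>v\<close> and the phantom \<open>0\<close>; what matters is
  that it strictly decreases towards the root.\<close>

definition depth :: "nat \<Rightarrow> nat" where
  "depth v = card {w. anc p v w}"

lemma depth_parent:
  assumes "v \<noteq> 0"
  shows "depth (p v) < depth v"
  unfolding depth_def
proof (rule psubset_card_mono)
  have "w \<in> insert v {0..n}" if "anc p v w" for w
    using that
  proof (induction rule: rtranclp_induct)
    case (step y z)
    then show ?case using forest by (auto simp: forest_def)
  qed simp
  then have "{w. anc p v w} \<subseteq> insert v {0..n}" by blast
  then show "finite {w. anc p v w}" by (rule finite_subset) simp
  have "v \<notin> {w. anc p (p v) w}" using forest_acyclic[OF forest, of v] assms by blast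
  moreover have "{w. anc p v w} = insert v {w. anc p (p v) w}" using anc_iff[of p v] by auto
  ultimately show "{w. anc p (p v) w} \<subset> {w. anc p v w}" by auto
qed

text \<open>The deepest vertex of a cycle would have two different parents, its two neighbours.\<close>

lemma acyclic: "\<not> graph_cycle T q"
proof
  assume "graph_cycle T q"
  then have q: "set q \<subseteq> {1..n}" "distinct q" "successively (\<lambda>u v. {u, v} \<in> Edges T) q"
    "3 \<le> length q" "{last q, hd q} \<in> Edges T"
    by (auto simp: graph_cycle_def simple_path_def)
  then have "q \<noteq> []" by auto
  then have "Max (depth ` set q) \<in> depth ` set q" by (intro Max_in) auto
  then obtain x where x: "x \<in> set q" "depth x = Max (depth ` set q)" by auto
  have parent: "y = p x" if "y \<in> set q" "{x, y} \<in> Edges T" for y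
  proof (rule ccontr)
    assume "y \<noteq> p x"
    then have "p y = x" using that(2) by (auto simp: edge_graph_of)
    moreover have "y \<noteq> 0" using that(1) q(1) by auto
    ultimately have "depth x < depth y" using depth_parent[of y] by simp
    moreover have "depth y \<le> depth x" using x(2) that(1) by simp
    ultimately show False by simp
  qed
  obtain a b where ab: "q = a @ x # b" using x(1) by (auto dest: split_list)
  \<comment> \<open>These are the neighbours of \<open>x\<close> in cyclic order. If
    \<open>x\<close> is first or last in \<open>q\<close>, one of them is reached through the
    closing edge; a length of at least 3 keeps them distinct.\<close>
  have "\<exists>y z. y \<in> set q \<and> z \<in> set q \<and> y \<noteq> z \<and> {x, y} \<in> Edges T \<and> {x, z} \<in> Edges T"
  proof (cases "a = []")
    case True
    then obtain c d e where "b = c # d # e" using q(4) ab by (cases b; cases "tl b") auto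
    then have qc: "q = x # c # d # e" using True ab by simp
    have "{x, c} \<in> Edges T" using q(3) by (simp add: qc)
    moreover have "{x, last (d # e)} \<in> Edges T" using q(5) by (simp add: qc insert_commute)
    moreover have "last (d # e) \<in> set (d # e)" by (rule last_in_set) simp
    moreover then have "c \<noteq> last (d # e)" using q(2) by (auto simp: qc)
    ultimately show ?thesis unfolding qc by (metis list.set_intros)
  next
    case a: False
    show ?thesis
    proof (cases "b = []")
      case True
      then obtain c d where "a = c # d" "d \<noteq> []" using q(4) ab a by (cases a; cases "tl a") auto
      then have qd: "q = c # d @ [x]" using True ab by simp
      have "{x, c} \<in> Edges T" using q(5) by (simp add: qd)
      moreover have "{x, last d} \<in> Edges T"
        using q(3) \<open>d \<noteq> []\<close> by (simp add: qd successively_append_iff successively_Cons insert_commute)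
      moreover have "last d \<in> set q" "c \<noteq> last d" using q(2) \<open>d \<noteq> []\<close> by (auto simp: qd)
      moreover have "c \<in> set q" by (simp add: qd)
      ultimately show ?thesis by blast
    next
      case False
      have "{x, last a} \<in> Edges T" "{x, hd b} \<in> Edges T"
        using q(3) a False by (simp_all add: ab successively_append_iff successively_Cons insert_commute)
      moreover have mem: "last a \<in> set a" "hd b \<in> set b" using a False by auto
      moreover have "last a \<noteq> hd b" using q(2) mem by (auto simp: ab)
      moreover have "last a \<in> set q" "hd b \<in> set q" using mem by (simp_all add: ab)
      ultimately show ?thesis by blast
    qed
  qed
  then show False using parent by blast
qed

lemma rooted_tree: "rooted_tree T"
proof -
  have "\<exists>u \<in> {1..n}. \<exists>v \<in> {1..n}. u \<noteq> v \<and> e = {u, v}" if e: "e \<in> Edges T" for e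
  proof -
    obtain v where v: "e = {v, p v}" "p v \<noteq> 0" using e by (auto simp: graph_of_def)
    have "v \<in> {1..n}" "p v \<in> {1..n}" using forest_vertex[OF forest v(2)] by auto
    moreover have "v \<noteq> p v" using forest_acyclic[OF forest, of v] v(2) by auto
    ultimately show ?thesis using v(1) by blast
  qed
  then show ?thesis
    using root(1) connected acyclic by (simp add: rooted_tree_def)
qed

text \<open>A simple path from the root can never turn upwards: the parent of its current end is the
  vertex visited just before, and the root has no parent vertex.\<close>

lemma path_from_root:
  assumes "simple_path T q" "hd q = r"
  shows "successively (\<lambda>u v. p v = u) q"
  using assms
proof (induction q rule: rev_induct)
  case (snoc x q)
  show ?case
  proof (cases "q = []")
    case False
    then have q: "simple_path T q" "hd q = r" and e: "{last q, x} \<in> Edges T" and x: "x \<notin> set q" "x \<noteq> 0"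
      using snoc.prems by (auto simp: simple_path_def successively_append_iff)
    have IH: "successively (\<lambda>u v. p v = u) q" using snoc.IH q by blast
    have "p (last q) \<noteq> x"
    proof (cases "butlast q = []")
      case True
      then have "q = [r]" using q(2) False by (cases q) (auto split: if_splits)
      then show ?thesis using root(2) x(2) by auto
    next
      case c: False
      have "q = butlast q @ [last q]" using False by simp
      then have "p (last q) = last (butlast q)"
        using IH c successively_append_iff[of "\<lambda>u v. p v = u" "butlast q" "[last q]"] by simp
      moreover have "last (butlast q) \<in> set q" using c in_set_butlastD last_in_set by metis
      ultimately show ?thesis using x(1) by auto
    qed
    then have "p x = last q" using e by (auto simp: edge_graph_of)
    then show ?thesis using IH False by (simp add: successively_append_iff)
  qed simp
qed simp

lemma set_path_from_root:
  assumes "successively (\<lambda>u v. p v = u) q" "q \<noteq> []" "hd q = r" "0 \<notin> set q"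
  shows "set q = {i. anc p (last q) i \<and> i \<noteq> 0}"
  using assms
proof (induction q rule: rev_induct)
  case (snoc x q)
  show ?case
  proof (cases "q = []")
    case True
    then have x: "x = r" using snoc.prems by simp
    have "anc p r i \<and> i \<noteq> 0 \<longleftrightarrow> i = r" for i
      using anc_iff[of p r i] root anc_from_0[OF forest, of i] by auto
    then show ?thesis using True x by auto
  next
    case False
    then have "p x = last q" "set q = {i. anc p (last q) i \<and> i \<noteq> 0}"
      using snoc by (auto simp: successively_append_iff)
    then show ?thesis using snoc.prems(4) anc_iff[of p x] by auto
  qed
qed simp

lemma descendant: "descendant T i j \<longleftrightarrow> j \<in> {1..n} \<and> i \<noteq> 0 \<and> anc p j i"
proof -
  have set_path: "set q = {i. anc p j i \<and> i \<noteq> 0}" if "path_between T r q j" for q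
  proof -
    have q: "simple_path T q" "hd q = r" "last q = j" using that by (auto simp: path_between_def)
    then have "q \<noteq> []" "0 \<notin> set q" by (auto simp: simple_path_def)
    then show ?thesis using set_path_from_root[OF path_from_root[OF q(1,2)]] q by simp
  qed
  have "j \<in> {1..n}" if "path_between T r q j" for q
    using that last_in_set[of q] by (auto simp: path_between_def simple_path_def)
  moreover have "\<exists>q. path_between T r q j" if "j \<in> {1..n}"
    using connected[OF root(1) that] .
  ultimately show ?thesis
    unfolding descendant_def using set_path by auto
qed

lemma children: "children T i = {j. p j = i \<and> i \<noteq> 0}"
proof (intro equalityI subsetI)
  fix j assume j: "j \<in> children T i"
  then have d: "{i, j} \<in> Edges T" "i \<noteq> 0" "anc p j i" by (auto simp: children_def descendant)
  have "p i \<noteq> j" using forest_acyclic[OF forest, of i] d(2,3) by auto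
  then show "j \<in> {j. p j = i \<and> i \<noteq> 0}" using d by (auto simp: edge_graph_of)
next
  fix j assume j: "j \<in> {j. p j = i \<and> i \<noteq> 0}"
  then have "j \<in> {1..n}" using forest_vertex[OF forest, of j] by auto
  then show "j \<in> children T i" using j anc_parent[of p j] by (auto simp: children_def descendant edge_graph_of)
qed

lemma improper: "p j \<noteq> 0 \<Longrightarrow> improper T (p j) j \<longleftrightarrow> j \<in> improper_children p"
proof -
  assume j: "p j \<noteq> 0"
  then have jn: "j \<in> {1..n}" using forest_vertex[OF forest] by blast
  have "l \<in> {1..n}" if l: "anc p l j" for l
  proof (cases "l = j")
    case False
    then have "anc p (p l) j" using l anc_iff[of p l j] by blast
    then have "p l \<noteq> 0" using anc_from_0[OF forest, of j] jn by (metis atLeastAtMost_iff not_one_le_zero)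
    then show ?thesis using forest_vertex[OF forest] by blast
  qed (use jn in auto)
  moreover have "j \<noteq> 0" using jn by simp
  ultimately have "descendant T j l \<longleftrightarrow> anc p l j" for l unfolding descendant by blast
  then show ?thesis by (simp add: improper_def improper_children_def)
qed

lemma imprope: "imprope T = card (improper_children p)"
proof -
  have "{(i, j). j \<in> children T i \<and> improper T i j} = (\<lambda>j. (p j, j)) ` improper_children p"
    using improper improper_children_parent_nonzero by (auto simp: children)
  then show ?thesis by (simp add: imprope_def card_image inj_on_def)
qed

lemma prope: "prope T = n - 1 - card (improper_children p)"
proof -
  have "{(i, j). j \<in> children T i \<and> \<not> improper T i j} = (\<lambda>j. (p j, j)) ` ({1..n} - roots n p - improper_children p)"
  proof (intro equalityI subsetI; clarify)
    fix i j assume ij: "j \<in> children T i" "\<not> improper T i j"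
    then have j: "p j = i" "p j \<noteq> 0" by (auto simp: children)
    then have "j \<in> {1..n} - roots n p - improper_children p"
      using ij(2) improper[OF j(2)] forest_vertex[OF forest j(2)] by (simp add: roots_def)
    then show "(i, j) \<in> (\<lambda>j. (p j, j)) ` ({1..n} - roots n p - improper_children p)" using j(1) by blast
  next
    fix j assume j: "j \<in> {1..n}" "j \<notin> roots n p" "j \<notin> improper_children p"
    then have "p j \<noteq> 0" by (simp add: roots_def)
    then show "j \<in> children T (p j) \<and> \<not> improper T (p j) j"
      using j(3) improper by (simp add: children)
  qed
  then have "prope T = card ({1..n} - roots n p - improper_children p)"
    by (simp add: prope_def card_image inj_on_def)
  also have "\<dots> = card ({1..n} - roots n p) - card (improper_children p)"
  proof (rule card_Diff_subset[OF finite_improper_children[OF forest]])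
    show "improper_children p \<subseteq> {1..n} - roots n p"
    proof
      fix j assume "j \<in> improper_children p"
      then have "p j \<noteq> 0" by (rule improper_children_parent_nonzero)
      then show "j \<in> {1..n} - roots n p" using forest_vertex[OF forest] by (simp add: roots_def)
    qed
  qed
  also have "card ({1..n} - roots n p) = n - 1"
    using tree by (subst card_Diff_subset) (auto simp: parent_tree_def roots_def)
  finally show ?thesis .
qed

end

section \<open>The bijection between parent functions and rooted trees\<close>

lemma inj_on_graph_of: "inj_on (graph_of n) {p. parent_tree n p}"
proof (rule inj_onI)
  fix p q assume "p \<in> {p. parent_tree n p}" "q \<in> {p. parent_tree n p}" and eq: "graph_of n p = graph_of n q"
  then interpret p: rooted_parent_tree n p + q: rooted_parent_tree n q
    by (simp_all add: rooted_parent_tree_def)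
  have "p j = i \<and> i \<noteq> 0 \<longleftrightarrow> q j = i \<and> i \<noteq> 0" for i j
    using p.children[of i] q.children[of i] eq by auto
  then show "p = q" by (metis ext)
qed

text \<open>Choosing for each vertex a neighbour closer to the root yields a spanning tree of
  \<open>T\<close>. Any further edge of \<open>T\<close> would close a cycle with the path joining
  its ends in the spanning tree.\<close>

lemma graph_of_surj:
  assumes T: "rooted_tree T" "Verts T = {1..n}"
  shows "\<exists>p. parent_tree n p \<and> T = graph_of n p"
proof -
  let ?r = "Root T" and ?V = "{1..n}"
  have r: "?r \<in> ?V" using T by (auto simp: rooted_tree_def)
  \<comment> \<open>The number of vertices on a shortest path from the root; the last vertex but one
    of such a path is a closer neighbour.\<close>
  define d where "d v = (LEAST m. \<exists>q. path_between T ?r q v \<and> length q = m)" for v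
  have closer: "\<exists>u. u \<in> ?V \<and> {v, u} \<in> Edges T \<and> d u < d v" if v: "v \<in> ?V" "v \<noteq> ?r" for v
  proof -
    have "\<exists>m q. path_between T ?r q v \<and> length q = m"
      using T r v(1) unfolding rooted_tree_def by blast
    then have "\<exists>q. path_between T ?r q v \<and> length q = d v"
      unfolding d_def by (rule LeastI_ex)
    then obtain q where q: "path_between T ?r q v" "length q = d v" by blast
    then have "q \<noteq> []" by (auto simp: path_between_def simple_path_def)
    then have q_eq: "q = butlast q @ [v]" using q(1) by (metis append_butlast_last_id path_between_def)
    define b where "b = butlast q"
    have b: "b \<noteq> []"
    proof
      assume "b = []"
      then have "q = [v]" using q_eq b_def by simp
      then show False using q(1) v(2) by (simp add: path_between_def)
    qed
    have qb: "q = b @ [v]" using q_eq b_def by simp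
    have path: "path_between T ?r b (last b)" and e: "{last b, v} \<in> Edges T"
      using q(1) b unfolding qb path_between_def simple_path_def by (auto simp: successively_append_iff)
    have "d (last b) \<le> length b" unfolding d_def using path by (intro Least_le) blast
    moreover have "set b \<subseteq> ?V" using path T(2) by (simp add: path_between_def simple_path_def)
    then have "last b \<in> ?V" using last_in_set[OF b] by blast
    ultimately show ?thesis using e q(2) qb by (intro exI[of _ "last b"]) (auto simp: insert_commute)
  qed
  define p where "p v = (if v \<in> ?V \<and> v \<noteq> ?r then SOME u. u \<in> ?V \<and> {v, u} \<in> Edges T \<and> d u < d v else 0)" for v
  have p: "p v \<in> ?V" "{v, p v} \<in> Edges T" "d (p v) < d v" if "v \<in> ?V" "v \<noteq> ?r" for v
    using someI_ex[OF closer[OF that]] that by (auto simp: p_def)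
  have p0: "p v = 0" if "v \<notin> ?V \<or> v = ?r" for v using that unfolding p_def by auto
  have "anc p v 0" for v
  proof (induction "d v" arbitrary: v rule: less_induct)
    case less
    show ?case
    proof (cases "v \<in> ?V \<and> v \<noteq> ?r")
      case True
      then have "anc p (p v) 0" using less p(3) by blast
      then show ?thesis using anc_iff[of p v 0] by blast
    next
      case False
      then show ?thesis using p0[of v] anc_parent[of p v] by auto
    qed
  qed
  moreover have "p v \<le> n" for v using p(1)[of v] p0[of v] by (cases "v \<in> ?V \<and> v \<noteq> ?r") auto
  ultimately have forest: "forest n p" using p0 by (simp add: forest_def)
  have roots: "roots n p = {?r}"
  proof (intro equalityI subsetI)
    fix v assume "v \<in> roots n p"
    then have "v \<in> ?V" "p v = 0" by (auto simp: roots_def)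
    then show "v \<in> {?r}" using p(1)[of v] by (cases "v = ?r") auto
  next
    fix v assume "v \<in> {?r}"
    then show "v \<in> roots n p" using r p0[of v] by (simp add: roots_def)
  qed
  have tree: "parent_tree n p" using forest roots by (simp add: parent_tree_def)
  then interpret p: rooted_parent_tree n p by (simp add: rooted_parent_tree_def)
  have sub: "Edges (graph_of n p) \<subseteq> Edges T"
  proof
    fix e assume "e \<in> Edges (graph_of n p)"
    then obtain v where v: "e = {v, p v}" "p v \<noteq> 0" by (auto simp: graph_of_def)
    then show "e \<in> Edges T" using p(2)[of v] p0[of v] by auto
  qed
  have "Edges T \<subseteq> Edges (graph_of n p)"
  proof
    fix e assume e: "e \<in> Edges T"
    then obtain u v where uv: "u \<in> ?V" "v \<in> ?V" "u \<noteq> v" "e = {u, v}"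
      using T unfolding rooted_tree_def by metis
    show "e \<in> Edges (graph_of n p)"
    proof (rule ccontr)
      assume not: "e \<notin> Edges (graph_of n p)"
      obtain q where q: "path_between (graph_of n p) u q v" using p.connected uv(1,2) by blast
      then have "simple_path T q"
        using sub T(2) successively_mono[of "\<lambda>u v. {u, v} \<in> Edges (graph_of n p)" q "\<lambda>u v. {u, v} \<in> Edges T"]
        unfolding path_between_def simple_path_def by auto
      \<comment> \<open>A path with one vertex would force \<open>u = v\<close>, and one with two
        vertices would be the edge \<open>e\<close> inside the spanning tree.\<close>
      moreover have "3 \<le> length q"
      proof (rule ccontr)
        assume "\<not> 3 \<le> length q"
        then consider "q = []" | x where "q = [x]" | x y where "q = [x, y]"
          by (cases q; cases "tl q"; cases "tl (tl q)") auto
        then show False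
          using q uv not by cases (auto simp: path_between_def simple_path_def)
      qed
      moreover have "{last q, hd q} \<in> Edges T"
        using q e uv(4) by (auto simp: path_between_def insert_commute)
      ultimately have "graph_cycle T q" by (simp add: graph_cycle_def)
      then show False using T(1) by (auto simp: rooted_tree_def)
    qed
  qed
  then have "T = graph_of n p"
    using sub T(2) roots by (intro rooted_graph.equality) auto
  then show ?thesis using tree by blast
qed

lemma t_poly_eq_tree_sum: "t_poly n k = tree_sum y_var z_var n k"
proof -
  let ?P = "{p. parent_tree (Suc n) p \<and> card (kids p 1) = k}"
  have loc: "rooted_parent_tree (Suc n) p" if "parent_tree (Suc n) p" for p
    using that by (simp add: rooted_parent_tree_def)
  have children: "children (graph_of (Suc n) p) 1 = kids p 1" if "parent_tree (Suc n) p" for p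
    using rooted_parent_tree.children[OF loc[OF that], of 1] by simp
  have "trees_one_children (n + 1) k = graph_of (Suc n) ` ?P"
  proof (intro equalityI subsetI)
    fix T assume "T \<in> trees_one_children (n + 1) k"
    then have T: "rooted_tree T" "Verts T = {1..Suc n}" "card (children T 1) = k"
      by (simp_all add: trees_one_children_def)
    then obtain p where p: "parent_tree (Suc n) p" "T = graph_of (Suc n) p" using graph_of_surj by blast
    then show "T \<in> graph_of (Suc n) ` ?P" using T(3) children[OF p(1)] by simp
  next
    fix T assume "T \<in> graph_of (Suc n) ` ?P"
    then obtain p where p: "parent_tree (Suc n) p" "card (kids p 1) = k" "T = graph_of (Suc n) p" by blast
    then show "T \<in> trees_one_children (n + 1) k"
      using children[OF p(1)] rooted_parent_tree.rooted_tree[OF loc[OF p(1)]] by (simp add: trees_one_children_def)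
  qed
  then have "t_poly n k = (\<Sum>p\<in>?P. y_var ^ imprope (graph_of (Suc n) p) * z_var ^ (prope (graph_of (Suc n) p) - k))"
    unfolding t_poly_def
    by (simp only:) (intro sum.reindex[unfolded o_def] inj_on_subset[OF inj_on_graph_of], auto)
  \<comment> \<open>With \<open>i\<close> improper edges, \<open>prope\<close> is
    \<open>n - i\<close>; the truncated subtractions of \<open>i\<close> and \<open>k\<close> from
    \<open>n\<close> can be interchanged.\<close>
  also have "\<dots> = tree_sum y_var z_var n k"
    unfolding tree_sum_def
    by (intro sum.cong refl) (simp add: rooted_parent_tree.imprope[OF loc] rooted_parent_tree.prope[OF loc] add.commute)
  finally show ?thesis .
qed

theorem theorem1p4:
  "unit_lower_triangular t_poly \<and>
   totally_positive coeffs_nonneg_yz t_poly \<and>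
   Hankel_totally_positive coeffs_nonneg_xyz T_poly"
proof -
  have init: "t_poly 0 k = (if k = 0 then 1 else 0)" for k
    unfolding t_poly_eq_tree_sum by (rule tree_sum_0)
  have supp: "t_poly n k = 0" if "n < k" for n k
    unfolding t_poly_eq_tree_sum using that by (rule tree_sum_eq_0)
  have rec_0: "t_poly (Suc n) 0 = y_var * t_poly (Suc n) 1" for n
    unfolding t_poly_eq_tree_sum by (rule tree_sum_rec_0)
  have rec_Suc: "t_poly (Suc n) (Suc k) = of_nat (Suc (Suc k)) * y_var * t_poly (Suc n) (Suc (Suc k)) +
      (\<Sum>j\<le>n. of_nat (j choose k) * z_var ^ (j - k) * t_poly n j)" for n k
    unfolding t_poly_eq_tree_sum by (rule tree_sum_rec_Suc)
  show ?thesis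
    using unit_lower_triangular_of_recurrence[OF init supp rec_0 rec_Suc]
      totally_positive_t_poly_of_recurrence[OF init supp rec_0 rec_Suc]
      Hankel_totally_positive_T_poly_of_recurrence[OF init supp rec_0 rec_Suc]
    by blast
qed

end
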